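(* Let $1\le p<\infty$, let $\varphi:\mathbb{N}\to\mathbb{N}$ be a map, let $w=(w_n)_{n\in\mathbb{N}}$ be a sequence of scalars, and let $wC_\varphi$ be an unbounded weighted pseudo-shift operator on $\ell^p$. Then $wC_\varphi$ is chaotic if and only if the following assertions hold: (1) $\varphi$ is injective. (2) $\varphi^n$ has no fixed point for any $n\in\mathbb{N}$. (3) For every $k\in\mathbb{N}$, $$\sum_{n=1}^{+\infty}\frac{1}{\left|w_k w_{\varphi(k)}\cdots w_{\varphi^{n-1}(k)}\right|^p}<+\infty$$ and $$\sum_{n=1}^{+\infty}\left|w_{\varphi^{-1}(k)}w_{\varphi^{-2}(k)}\cdots w_{\varphi^{-n}(k)}\right|^p<+\infty.$$
   Context: $\mathbb{N}=\{1,2,3,\dots\}$; $\mathbb{K}=\mathbb{R}$ or $\mathbb{C}$ is the scalar field; $\ell^p=\ell^p(\mathbb{N})$ over $\mathbb{K}$; $e_k$ ($k\in\mathbb{N}$) is the $k$-th canonical unit sequence; $\varphi^n$ is the $n$-fold iterate of $\varphi$. Weighted pseudo-shift on $\ell^p$: for $\varphi:\mathbb{N}\to\mathbb{N}$ and an arbitrary scalar sequence $(w_k)_{k\in\mathbb{N}}$, $wC_\varphi\big(\sum_{k}x_ke_k\big)=\sum_{k}w_kx_{\varphi(k)}e_k$ with domain $D(wC_\varphi)=\{x\in\ell^p: (w_kx_{\varphi(k)})_k\in\ell^p\}$. It is called unbounded when $\sup_{l\in\mathbb{N}}\sum_{k\in\varphi^{-1}(\{l\})}|w_k|^p=\infty$.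 Its powers are $(wC_\varphi)^n\big(\sum_k x_ke_k\big)=\sum_k w_kw_{\varphi(k)}\cdots w_{\varphi^{n-1}(k)}x_{\varphi^n(k)}e_k$ with domain $D((wC_\varphi)^n)=\{x\in\ell^p:(w_kw_{\varphi(k)}\cdots w_{\varphi^{n-1}(k)}x_{\varphi^n(k)})_k\in\ell^p\}$, for $n\in\mathbb{N}$, and $D((wC_\varphi)^\infty)=\bigcap_{n\ge1}D((wC_\varphi)^n)$. A densely defined (possibly unbounded) operator $T$ on a separable infinite-dimensional Banach space $X$ is hypercyclic if there is $f\in D(T^\infty)=\bigcap_{n\ge1}D(T^n)$ whose orbit $\{f,Tf,T^2f,\dots\}$ is dense in $X$. A vector $f$ is periodic for $T$ if there is $n\in\mathbb{N}$ with $f\in D(T^n)$ and $T^nf=f$. $T$ is chaotic if it is hypercyclic and its set of periodic points is dense in $X$. Negative iterates (for $\varphi$ injective): for $n,k\in\mathbb{N}$, $\varphi^{-n}(k)=l$ if there is $l\in\mathbb{N}$ with $\varphi^n(l)=k$, and $\varphi^{-n}(k)=0$ if there is no such $l$. Convention: $w_0=0$. In the first series $1/0$ is read as $+\infty$, so its finiteness requires the products to be nonzero.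
   Formalization: The domain of the n-th power is that of the n-fold composition (f, Tf, ..., T^n f all in l^p), not the displayed set {x in l^p : T^n x in l^p}; this restricts which vectors count as periodic. With the displayed set, chaos does not imply (3). *)

theory Defs
  imports "HOL-Analysis.Analysis"
begin

text \<open>
  The index set \<open>\<nat> = {1, 2, 3, \<dots>}\<close> is rendered as \<open>{1..} :: nat set\<close>. A scalar sequence is a
  function on \<^typ>\<open>nat\<close> whose value at the extra index \<open>0\<close> is \<open>0\<close>; this makes the representation
  unique and fits the convention \<open>w\<^sub>0 = 0\<close>.

  The scalar field \<open>\<real>\<close> or \<open>\<complex>\<close> is rendered as a type of sort
  \<open>{real_normed_field, euclidean_space}\<close>: \<^typ>\<open>real\<close> and \<^typ>\<open>complex\<close> are instances and, up to
  isometric isomorphism, the only ones. The definitions need only \<open>real_normed_field\<close>.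
\<close>

definition lp :: "real \<Rightarrow> (nat \<Rightarrow> 'a::real_normed_field) set" where
  "lp p = {x. x 0 = 0 \<and> summable (\<lambda>k. norm (x k) powr p)}"

definition lp_norm :: "real \<Rightarrow> (nat \<Rightarrow> 'a::real_normed_field) \<Rightarrow> real" where
  "lp_norm p x = (\<Sum>k. norm (x k) powr p) powr (1 / p)"

definition lp_dist :: "real \<Rightarrow> (nat \<Rightarrow> 'a::real_normed_field) \<Rightarrow> (nat \<Rightarrow> 'a) \<Rightarrow> real" where
  "lp_dist p x y = lp_norm p (\<lambda>k. x k - y k)"

definition lp_topology :: "real \<Rightarrow> (nat \<Rightarrow> 'a::real_normed_field) topology" where
  "lp_topology p = Metric_space.mtopology (lp p) (lp_dist p)"


text \<open>
  A possibly unbounded operator in a space \<open>X\<close> is given by its domain \<open>D\<close> and a function \<open>T\<close>, of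
  which only the values on \<open>D\<close> matter. Its power \<open>T\<^sup>n\<close> is the \<open>n\<close>-fold composition of partial maps:
  \<open>f\<close> is in its domain when \<open>f, T f, \<dots>, T\<^sup>n\<^sup>-\<^sup>1 f\<close> all lie in \<open>D\<close>. Only \<open>n \<ge> 1\<close> is used.
\<close>

definition power_domain :: "'b set \<Rightarrow> ('b \<Rightarrow> 'b) \<Rightarrow> nat \<Rightarrow> 'b set" where
  "power_domain D T n = {f. \<forall>m<n. (T ^^ m) f \<in> D}"

definition power_domain_inf :: "'b set \<Rightarrow> ('b \<Rightarrow> 'b) \<Rightarrow> 'b set" where
  "power_domain_inf D T = (\<Inter>n\<in>{1..}. power_domain D T n)"

definition dense_in :: "'b topology \<Rightarrow> 'b set \<Rightarrow> bool" where
  "dense_in X S \<longleftrightarrow> X closure_of S = topspace X"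

definition hypercyclic :: "'b topology \<Rightarrow> 'b set \<Rightarrow> ('b \<Rightarrow> 'b) \<Rightarrow> bool" where
  "hypercyclic X D T \<longleftrightarrow>
     dense_in X D \<and> (\<exists>f\<in>power_domain_inf D T. dense_in X (range (\<lambda>n. (T ^^ n) f)))"

definition periodic_points :: "'b set \<Rightarrow> ('b \<Rightarrow> 'b) \<Rightarrow> 'b set" where
  "periodic_points D T = {f. \<exists>n\<ge>1. f \<in> power_domain D T n \<and> (T ^^ n) f = f}"

definition chaotic :: "'b topology \<Rightarrow> 'b set \<Rightarrow> ('b \<Rightarrow> 'b) \<Rightarrow> bool" where
  "chaotic X D T \<longleftrightarrow> hypercyclic X D T \<and> dense_in X (periodic_points D T)"


definition pseudo_shift :: "(nat \<Rightarrow> nat) \<Rightarrow> (nat \<Rightarrow> 'a::real_normed_field) \<Rightarrow> (nat \<Rightarrow> 'a) \<Rightarrow> nat \<Rightarrow> 'a"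
  where "pseudo_shift \<phi> w x = (\<lambda>k. if k = 0 then 0 else w k * x (\<phi> k))"

definition pseudo_shift_domain ::
    "real \<Rightarrow> (nat \<Rightarrow> nat) \<Rightarrow> (nat \<Rightarrow> 'a::real_normed_field) \<Rightarrow> (nat \<Rightarrow> 'a) set"
  where "pseudo_shift_domain p \<phi> w = {x \<in> lp p. pseudo_shift \<phi> w x \<in> lp p}"

definition pseudo_shift_unbounded ::
    "real \<Rightarrow> (nat \<Rightarrow> nat) \<Rightarrow> (nat \<Rightarrow> 'a::real_normed_field) \<Rightarrow> bool"
  where "pseudo_shift_unbounded p \<phi> w \<longleftrightarrow>
    (SUP l\<in>{1..}. \<Sum>\<^sub>\<infinity>k\<in>{k\<in>{1..}. \<phi> k = l}. ennreal (norm (w k) powr p)) = \<infinity>"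

text \<open>\<open>\<phi>\<^sup>-\<^sup>n(k)\<close>, meaningful for \<open>\<phi>\<close> injective on \<open>{1..}\<close>; it is \<open>0\<close> if \<open>k\<close> has no preimage.\<close>

definition neg_iterate :: "(nat \<Rightarrow> nat) \<Rightarrow> nat \<Rightarrow> nat \<Rightarrow> nat" where
  "neg_iterate \<phi> n k =
     (if \<exists>l\<ge>1. (\<phi> ^^ n) l = k then THE l. l \<ge> 1 \<and> (\<phi> ^^ n) l = k else 0)"


lemma pseudo_shift_funpow:
  assumes "\<phi> \<in> {1..} \<rightarrow> {1..}" and "k \<ge> 1"
  shows "(pseudo_shift \<phi> w ^^ n) x k = (\<Prod>j<n. w ((\<phi> ^^ j) k)) * x ((\<phi> ^^ n) k)"
  using assms(2)
proof (induction n arbitrary: k)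
  case 0
  then show ?case by simp
next
  case (Suc n)
  have "\<phi> k \<ge> 1" using assms(1) Suc.prems by auto
  then have "(pseudo_shift \<phi> w ^^ Suc n) x k
      = w k * ((\<Prod>j<n. w ((\<phi> ^^ j) (\<phi> k))) * x ((\<phi> ^^ n) (\<phi> k)))"
    using Suc.prems Suc.IH[of "\<phi> k"] by (simp add: pseudo_shift_def[of \<phi> w "(pseudo_shift \<phi> w ^^ n) x"])
  also have "\<dots> = (\<Prod>j<Suc n. w ((\<phi> ^^ j) k)) * x ((\<phi> ^^ Suc n) k)"
    unfolding prod.lessThan_Suc_shift by (simp add: funpow_swap1 del: prod.lessThan_Suc)
  finally show ?case .
qed

text \<open>
  The set \<open>{x \<in> \<ell>\<^sup>p. T\<^sup>n x \<in> \<ell>\<^sup>p}\<close> may be strictly larger than the domain of the composition \<open>T\<^sup>n\<close>,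
  because intermediate images can leave \<open>\<ell>\<^sup>p\<close>. The two domains agree for \<open>n = 1\<close>, and both families
  have the same intersection over all \<open>n\<close>.
\<close>

lemma power_domain_pseudo_shift:
  assumes "n \<ge> 1"
  shows "power_domain (pseudo_shift_domain p \<phi> w) (pseudo_shift \<phi> w) n
       = {x \<in> lp p. \<forall>m\<in>{1..n}. (pseudo_shift \<phi> w ^^ m) x \<in> lp p}"
proof -
  have "(\<forall>m<n. (pseudo_shift \<phi> w ^^ m) x \<in> lp p \<and> (pseudo_shift \<phi> w ^^ Suc m) x \<in> lp p) \<longleftrightarrow>
        x \<in> lp p \<and> (\<forall>m\<in>{1..n}. (pseudo_shift \<phi> w ^^ m) x \<in> lp p)" (is "?L \<longleftrightarrow> ?R") for x
  proof
    assume L: ?L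
    have "x \<in> lp p" using L[rule_format, of 0] assms by simp
    moreover have "(pseudo_shift \<phi> w ^^ m) x \<in> lp p" if "m \<in> {1..n}" for m
      using L[rule_format, of "m - 1"] that by (cases m) auto
    ultimately show ?R by blast
  next
    assume R: ?R
    have "(pseudo_shift \<phi> w ^^ m) x \<in> lp p" if "m \<le> n" for m
      using R that by (cases "m = 0") auto
    then show ?L by (metis Suc_leI less_imp_le)
  qed
  then show ?thesis
    by (auto simp: power_domain_def pseudo_shift_domain_def)
qed

lemma power_domain_inf_pseudo_shift:
  "power_domain_inf (pseudo_shift_domain p \<phi> w) (pseudo_shift \<phi> w)
     = (\<Inter>n\<in>{1..}. {x \<in> lp p. (pseudo_shift \<phi> w ^^ n) x \<in> lp p})"
  by (force simp: power_domain_inf_def power_domain_pseudo_shift)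

end

theory Submission
  imports Defs
begin

text \<open>
  Write \<open>T\<close> for the operator and \<open>P\<^sub>n(k) = w\<^sub>k w\<^bsub>\<phi>(k)\<^esub> \<cdots>\<close> (\<open>n\<close> factors), so that
  \<open>(T\<^sup>n x)\<^sub>k = P\<^sub>n(k) x\<^sub>l\<close> with \<open>l = \<phi>\<^sup>n(k)\<close>.

  A dense orbit forbids anything that ties down one or two coordinates of \<open>T\<^sup>n f\<close>. A zero weight
  \<open>w\<^sub>k\<close> would kill the \<open>k\<close>-th coordinate, \<open>\<phi>(k) = \<phi>(l)\<close> would make two coordinates proportional, and a
  periodic point of \<open>\<phi>\<close> would multiply one coordinate by the same constant every \<open>n\<close> steps
  (\<open>dense_orbit_no_relation\<close>, \<open>dense_orbit_no_fixed_point\<close>). The two series come from a periodic vector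
  \<open>x\<close> with \<open>x\<^sub>k \<noteq> 0\<close>: its orbit consists of finitely many vectors of \<open>\<ell>\<^sup>p\<close>, among whose coordinates along
  the orbit of \<open>k\<close> are all the numbers \<open>x\<^sub>k / P\<^sub>n(k)\<close> forwards and \<open>P\<^sub>n(l) x\<^sub>k\<close>, with \<open>\<phi>\<^sup>n(l) = k\<close>, backwards
  (\<open>periodic_vector_summability\<close>).

  Conversely, those numbers without the factor \<open>x\<^sub>k\<close>, placed on the two-sided orbit of \<open>k\<close>, form a
  vector \<open>g\<close> with \<open>T g = g\<close>, and the two series say exactly that \<open>g \<in> \<ell>\<^sup>p\<close> (\<open>orbit_part_UNIV_in_lp\<close>).
  Restricting \<open>g\<close> to a set \<open>A\<close> of positions on the orbit gives vectors on which \<open>T\<close> acts by shifting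
  \<open>A\<close> (\<open>T_orbit_part\<close>) and whose norm is small if \<open>A\<close> is far from position \<open>0\<close> (\<open>orbit_part_far\<close>). The
  position \<open>0\<close> alone gives \<open>e\<^sub>k\<close>; the multiples of a large \<open>N\<close> give a periodic vector close to \<open>e\<^sub>k\<close>;
  and a hypercyclic vector is a series of finite combinations placed at rapidly increasing positions
  (\<open>hypercyclic_vector_exists\<close>). Each vector of a dense sequence comes back to position \<open>0\<close> at its own
  time, when all the others are far out.
\<close>

section \<open>The normed space of p-summable sequences\<close>

lemma lp_zero_index: "x \<in> lp p \<Longrightarrow> x 0 = 0"
  by (simp add: lp_def)

lemma lp_summable: "x \<in> lp p \<Longrightarrow> summable (\<lambda>k. norm (x k) powr p)"
  by (simp add: lp_def)

lemma lp_norm_nonneg [simp]: "0 \<le> lp_norm p x"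
  by (simp add: lp_norm_def)

lemma lp_norm_powr:
  assumes "p > 0" and "x \<in> lp p"
  shows "lp_norm p x powr p = (\<Sum>k. norm (x k) powr p)"
  using assms by (simp add: lp_norm_def powr_powr suminf_nonneg lp_summable)

lemma powr_le_powr_iff:
  fixes a b p :: real
  assumes "p > 0" and "a \<ge> 0" and "b \<ge> 0"
  shows "a powr p \<le> b powr p \<longleftrightarrow> a \<le> b"
  using assms powr_less_mono2[of p b a] powr_mono2[of p a b] by fastforce

lemma lp_boundedI:
  assumes "p > 0" and "x 0 = 0" and "c \<ge> 0"
    and "\<And>L. (\<Sum>k<L. norm (x k) powr p) \<le> c powr p"
  shows "x \<in> lp p" and "lp_norm p x \<le> c"
proof -
  have "summable (\<lambda>k. norm (x k) powr p)"
    by (rule summableI_nonneg_bounded[OF _ assms(4)]) simp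
  then show x: "x \<in> lp p" using assms(2) by (simp add: lp_def)
  have "lp_norm p x powr p \<le> c powr p"
    using lp_norm_powr[OF assms(1) x] suminf_le_const[OF lp_summable[OF x] assms(4)] by simp
  then show "lp_norm p x \<le> c" using powr_le_powr_iff assms by auto
qed

lemma lp_partial_sum_le:
  assumes "p > 0" and "x \<in> lp p" and "finite F"
  shows "(\<Sum>k\<in>F. norm (x k) powr p) \<le> lp_norm p x powr p"
  using assms by (simp add: lp_norm_powr sum_le_suminf lp_summable)

lemma lp_dominated:
  assumes "p > 0" and "y \<in> lp p" and "\<And>k. norm (x k) \<le> norm (y k)"
  shows "x \<in> lp p" and "lp_norm p x \<le> lp_norm p y"
proof -
  have 0: "x 0 = 0" using assms(3)[of 0] lp_zero_index[OF assms(2)] by simp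
  have "(\<Sum>k<L. norm (x k) powr p) \<le> lp_norm p y powr p" for L
    by (rule order.trans[OF sum_mono lp_partial_sum_le[OF assms(1,2)]])
      (use assms in \<open>auto intro: powr_mono2\<close>)
  then show "x \<in> lp p" "lp_norm p x \<le> lp_norm p y"
    using lp_boundedI[where x = x and c = "lp_norm p y", OF assms(1) 0] by auto
qed

lemma lp_coordinate_le:
  assumes "p > 0" and "x \<in> lp p"
  shows "norm (x k) \<le> lp_norm p x"
  using lp_partial_sum_le[OF assms, of "{k}"] powr_le_powr_iff[OF assms(1)] by simp

lemma lp_norm_eq_0_iff:
  assumes "p > 0" and "x \<in> lp p"
  shows "lp_norm p x = 0 \<longleftrightarrow> x = (\<lambda>k. 0)"
proof
  assume "lp_norm p x = 0"
  then show "x = (\<lambda>k. 0)" using lp_coordinate_le[OF assms] by auto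
qed (simp add: lp_norm_def)

lemma powr_convex_combination_le:
  fixes s t u p :: real
  assumes "1 \<le> p" and "0 \<le> s" and "0 \<le> t" and "0 \<le> u" and "u \<le> 1"
  shows "(u * s + (1 - u) * t) powr p \<le> u * s powr p + (1 - u) * t powr p"
proof -
  \<comment> \<open>Convexity on the open half-line leaves the boundary cases, where \<open>u\<^sup>p \<le> u\<close> suffices.\<close>
  have pow: "v powr p \<le> v" if "0 \<le> v" "v \<le> 1" for v :: real
    using powr_mono'[of 1 p v] that assms(1) by simp
  consider "s = 0" | "t = 0" | "s > 0" "t > 0" using assms by linarith
  then show ?thesis
  proof cases
    case 1
    then show ?thesis using pow[of "1 - u"] assms
      by (auto simp: powr_mult intro!: mult_right_mono)
  next
    case 2
    then show ?thesis using pow[of u] assms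
      by (auto simp: powr_mult intro!: mult_right_mono)
  next
    case 3
    then show ?thesis
      using convex_onD[OF powr_convex[OF assms(1)], of "1 - u" s t] assms by (simp add: algebra_simps)
  qed
qed

text \<open>
  Minkowski's inequality. With \<open>a = \<parallel>x\<parallel>\<close> and \<open>b = \<parallel>y\<parallel>\<close>, the scalar \<open>(\<bar>x\<^sub>k\<bar> + \<bar>y\<^sub>k\<bar>) / (a + b)\<close> is the
  convex combination of \<open>\<bar>x\<^sub>k\<bar> / a\<close> and \<open>\<bar>y\<^sub>k\<bar> / b\<close> with weights \<open>a / (a + b)\<close> and \<open>b / (a + b)\<close>;
  convexity of the \<open>p\<close>-th power is summed over \<open>k\<close>.
\<close>

lemma lp_Minkowski:
  assumes p: "1 \<le> p" and x: "x \<in> lp p" and y: "y \<in> lp p"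
  shows "(\<lambda>k. x k + y k) \<in> lp p \<and> lp_norm p (\<lambda>k. x k + y k) \<le> lp_norm p x + lp_norm p y"
proof -
  define a b where "a = lp_norm p x" and "b = lp_norm p y"
  have p0: "p > 0" using p by simp
  have ab: "a \<ge> 0" "b \<ge> 0" by (simp_all add: a_def b_def)
  consider "a = 0" | "b = 0" | "a > 0" "b > 0" using ab by linarith
  then show ?thesis
  proof cases
    case 1
    then have "x = (\<lambda>k. 0)" using lp_norm_eq_0_iff[OF p0 x] by (simp add: a_def)
    then show ?thesis using y ab by (simp add: a_def)
  next
    case 2
    then have "y = (\<lambda>k. 0)" using lp_norm_eq_0_iff[OF p0 y] by (simp add: b_def)
    then show ?thesis using x ab by (simp add: b_def)
  next
    case 3
    define u where "u = a / (a + b)"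
    have u: "0 \<le> u" "u \<le> 1" "1 - u = b / (a + b)" using 3 by (auto simp: u_def field_simps)
    have pt: "norm (x k + y k) powr p
        \<le> (a + b) powr p * (u * (norm (x k) powr p / a powr p)
                           + (1 - u) * (norm (y k) powr p / b powr p))" for k
    proof -
      have "norm (x k + y k) powr p \<le> (norm (x k) + norm (y k)) powr p"
        using p by (auto intro: powr_mono2 norm_triangle_ineq)
      also have "norm (x k) + norm (y k)
          = (a + b) * (u * (norm (x k) / a) + (1 - u) * (norm (y k) / b))"
        unfolding u(3) using 3 by (simp add: u_def add_divide_distrib[symmetric])
      also have "\<dots> powr p
          = (a + b) powr p * (u * (norm (x k) / a) + (1 - u) * (norm (y k) / b)) powr p"
        using 3 u by (auto intro!: powr_mult add_nonneg_nonneg mult_nonneg_nonneg)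
      also have "\<dots> \<le> (a + b) powr p * (u * (norm (x k) / a) powr p + (1 - u) * (norm (y k) / b) powr p)"
        using powr_convex_combination_le[OF p, of "norm (x k) / a" "norm (y k) / b" u] 3 u
        by (auto intro: mult_left_mono)
      finally show ?thesis using 3 by (simp add: powr_divide)
    qed
    have "(\<Sum>k<L. norm (x k + y k) powr p) \<le> (a + b) powr p" for L
    proof -
      have X: "(\<Sum>k<L. norm (x k) powr p) / a powr p \<le> 1"
        using lp_partial_sum_le[OF p0 x, of "{..<L}"] 3 by (simp add: a_def)
      have Y: "(\<Sum>k<L. norm (y k) powr p) / b powr p \<le> 1"
        using lp_partial_sum_le[OF p0 y, of "{..<L}"] 3 by (simp add: b_def)
      have "(\<Sum>k<L. norm (x k + y k) powr p)
          \<le> (\<Sum>k<L. (a + b) powr p * (u * (norm (x k) powr p / a powr p)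
                           + (1 - u) * (norm (y k) powr p / b powr p)))"
        by (rule sum_mono) (rule pt)
      also have "\<dots> = (a + b) powr p * (u * ((\<Sum>k<L. norm (x k) powr p) / a powr p)
                           + (1 - u) * ((\<Sum>k<L. norm (y k) powr p) / b powr p))"
        by (simp add: sum.distrib flip: sum_distrib_left sum_divide_distrib)
      also have "\<dots> \<le> (a + b) powr p * (u * 1 + (1 - u) * 1)"
        using X Y u by (intro mult_left_mono add_mono) auto
      finally show ?thesis by simp
    qed
    then show ?thesis
      using lp_boundedI[OF p0, of "\<lambda>k. x k + y k" "a + b"] lp_zero_index[OF x] lp_zero_index[OF y] ab by (simp add: a_def b_def)
  qed
qed

lemma lp_scale:
  assumes "p > 0" and "x \<in> lp p"
  shows "(\<lambda>k. c * x k) \<in> lp p \<and> lp_norm p (\<lambda>k. c * x k) \<le> norm c * lp_norm p x"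
proof -
  have "(\<Sum>k<L. norm (c * x k) powr p) \<le> (norm c * lp_norm p x) powr p" for L
  proof -
    have "(\<Sum>k<L. norm (c * x k) powr p) = norm c powr p * (\<Sum>k<L. norm (x k) powr p)"
      by (simp add: norm_mult powr_mult sum_distrib_left)
    also have "\<dots> \<le> norm c powr p * lp_norm p x powr p"
      by (intro mult_left_mono lp_partial_sum_le assms) auto
    finally show ?thesis by (simp add: powr_mult)
  qed
  then show ?thesis using lp_boundedI[OF assms(1), of "\<lambda>k. c * x k" "norm c * lp_norm p x"]
      lp_zero_index[OF assms(2)] by simp
qed

lemma lp_zero: "p > 0 \<Longrightarrow> (\<lambda>k. 0) \<in> lp p \<and> lp_norm p (\<lambda>k. 0) = 0"
  by (simp add: lp_def lp_norm_def)

lemma lp_diff: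
  assumes "1 \<le> p" and "x \<in> lp p" and "y \<in> lp p"
  shows "(\<lambda>k. x k - y k) \<in> lp p"
  using lp_Minkowski[OF assms(1,2), of "\<lambda>k. - 1 * y k"] lp_scale[of p y "- 1"] assms by simp

lemma lp_sum:
  assumes p: "1 \<le> p" and "finite J" and "\<And>j. j \<in> J \<Longrightarrow> u j \<in> lp p"
  shows "(\<lambda>k. \<Sum>j\<in>J. u j k) \<in> lp p \<and>
    lp_norm p (\<lambda>k. \<Sum>j\<in>J. u j k) \<le> (\<Sum>j\<in>J. lp_norm p (u j))"
  using assms(2,3)
proof (induction J rule: finite_induct)
  case empty
  then show ?case using p by (simp add: lp_zero)
next
  case (insert j J)
  then show ?case
    using lp_Minkowski[OF p, of "u j" "\<lambda>k. \<Sum>j\<in>J. u j k"] by fastforce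
qed

text \<open>
  Completeness of \<open>\<ell>\<^sup>p\<close> is used in the following form: an absolutely convergent series in \<open>\<ell>\<^sup>p\<close> may be summed
  coordinatewise. Each partial sum over \<open>k < L\<close> of the limit is a limit of partial sums of the
  finite sums, which Minkowski's inequality bounds.
\<close>

lemma lp_suminf:
  fixes u :: "nat \<Rightarrow> nat \<Rightarrow> 'a::{real_normed_field, banach}"
  assumes p: "1 \<le> p" and u: "\<And>j. u j \<in> lp p" and s: "summable (\<lambda>j. lp_norm p (u j))"
  shows "summable (\<lambda>j. u j k)" and "(\<lambda>k. \<Sum>j. u j k) \<in> lp p"
    and "lp_norm p (\<lambda>k. \<Sum>j. u j k) \<le> (\<Sum>j. lp_norm p (u j))"
proof -
  have p0: "p > 0" using p by simp
  have c: "summable (\<lambda>j. u j k)" for k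
    by (rule summable_comparison_test'[OF s, of 0]) (use lp_coordinate_le[OF p0 u] in auto)
  then show "summable (\<lambda>j. u j k)" .
  define B where "B = (\<Sum>j. lp_norm p (u j))"
  have B: "B \<ge> 0" unfolding B_def by (rule suminf_nonneg[OF s]) simp
  have "(\<Sum>k<L. norm (\<Sum>j. u j k) powr p) \<le> B powr p" for L
  proof (rule LIMSEQ_le_const2)
    show "(\<lambda>J. \<Sum>k<L. norm (\<Sum>j<J. u j k) powr p) \<longlonglongrightarrow> (\<Sum>k<L. norm (\<Sum>j. u j k) powr p)"
      by (intro tendsto_sum tendsto_powr2 tendsto_norm summable_LIMSEQ c) (use p0 in auto)
    have "(\<Sum>k<L. norm (\<Sum>j<J. u j k) powr p) \<le> B powr p" for J
    proof -
      have 1: "(\<lambda>k. \<Sum>j<J. u j k) \<in> lp p"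
          "lp_norm p (\<lambda>k. \<Sum>j<J. u j k) \<le> (\<Sum>j<J. lp_norm p (u j))"
        using lp_sum[OF p, of "{..<J}" u] u by auto
      have "(\<Sum>j<J. lp_norm p (u j)) \<le> B"
        unfolding B_def by (rule sum_le_suminf[OF s]) auto
      then show ?thesis
        using lp_partial_sum_le[OF p0 1(1), of "{..<L}"] 1(2) p0
        by (smt (verit) finite_lessThan lp_norm_nonneg powr_mono2)
    qed
    then show "\<exists>N. \<forall>J\<ge>N. (\<Sum>k<L. norm (\<Sum>j<J. u j k) powr p) \<le> B powr p" by blast
  qed
  then show "(\<lambda>k. \<Sum>j. u j k) \<in> lp p" "lp_norm p (\<lambda>k. \<Sum>j. u j k) \<le> (\<Sum>j. lp_norm p (u j))"
    using lp_boundedI[OF p0, of "\<lambda>k. \<Sum>j. u j k" B] lp_zero_index[OF u] B by (auto simp: B_def)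
qed

lemma lp_Metric_space:
  assumes p: "1 \<le> p"
  shows "Metric_space (lp p) (lp_dist p)"
proof
  show "lp_dist p x y = lp_dist p y x" for x y :: "nat \<Rightarrow> 'a"
    by (simp add: lp_dist_def lp_norm_def norm_minus_commute)
  show "lp_dist p x y = 0 \<longleftrightarrow> x = y" if "x \<in> lp p" "y \<in> lp p" for x y :: "nat \<Rightarrow> 'a"
    using lp_norm_eq_0_iff[OF _ lp_diff[OF p that]] p by (auto simp: lp_dist_def fun_eq_iff)
  show "lp_dist p x z \<le> lp_dist p x y + lp_dist p y z"
    if "x \<in> lp p" "y \<in> lp p" "z \<in> lp p" for x y z :: "nat \<Rightarrow> 'a"
    using lp_Minkowski[OF p lp_diff[OF p that(1,2)] lp_diff[OF p that(2,3)]]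
    by (simp add: lp_dist_def)
qed (simp add: lp_dist_def)

lemma dense_in_lp_iff:
  assumes p: "1 \<le> p"
  shows "dense_in (lp_topology p) S \<longleftrightarrow>
    (\<forall>x\<in>lp p. \<forall>r>0. \<exists>y\<in>S. y \<in> lp p \<and> lp_norm p (\<lambda>k. x k - y k) < r)"
proof -
  interpret Metric_space "lp p" "lp_dist p :: (nat \<Rightarrow> 'a) \<Rightarrow> _" by (rule lp_Metric_space[OF p])
  show ?thesis
    unfolding dense_in_def lp_topology_def metric_closure_of topspace_mtopology
    by (auto simp: in_mball lp_dist_def)
qed

text \<open>Truncating late enough costs little, uniformly over all sequences dominated by a fixed one.\<close>

lemma lp_tail:
  fixes x :: "nat \<Rightarrow> 'a::real_normed_field"
  assumes p: "1 \<le> p" and x: "x \<in> lp p" and e: "e > 0"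
  shows "\<exists>L. \<forall>h :: nat \<Rightarrow> 'a. (\<forall>k. norm (h k) \<le> norm (x k)) \<and> (\<forall>k<L. h k = 0) \<longrightarrow> lp_norm p h < e"
proof -
  have p0: "p > 0" using p by simp
  have "e powr p > 0" using e by simp
  then obtain L where L: "norm (\<Sum>k. norm (x (k + L)) powr p) < e powr p"
    using suminf_exist_split[OF _ lp_summable[OF x]] by blast
  have "lp_norm p h < e" if dom: "\<forall>k. norm (h k) \<le> norm (x k)" and zero: "\<forall>k<L. h k = 0" for h :: "nat \<Rightarrow> 'a"
  proof -
    have h: "h \<in> lp p" using lp_dominated[OF p0 x] dom by blast
    have "lp_norm p h powr p = (\<Sum>k. norm (h k) powr p)" by (rule lp_norm_powr[OF p0 h])
    also have "\<dots> = (\<Sum>k. norm (h (k + L)) powr p)"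
      using suminf_split_initial_segment[OF lp_summable[OF h], of L] zero by simp
    also have "\<dots> \<le> (\<Sum>k. norm (x (k + L)) powr p)"
      using dom p0 lp_summable[OF x] lp_summable[OF h]
      by (intro suminf_le powr_mono2) (auto simp: summable_iff_shift[of "\<lambda>k. norm (_ k) powr p"])
    also have "\<dots> < e powr p" using L by simp
    finally show ?thesis using powr_mono2[of p e "lp_norm p h"] p0 e by linarith
  qed
  then show ?thesis by blast
qed

lemma single_in_lp:
  assumes "p > 0" and "k \<ge> 1"
  shows "(\<lambda>i. if i = k then c else 0) \<in> lp p" and "lp_norm p (\<lambda>i. if i = k then c else 0) \<le> norm c"
proof -
  have "(\<Sum>i<L. norm (if i = k then c else 0) powr p) \<le> norm c powr p" for L
  proof -
    have "(\<Sum>i<L. norm (if i = k then c else 0) powr p) = (\<Sum>i<L. if i = k then norm c powr p else 0)"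
      by (rule sum.cong) auto
    then show ?thesis by simp
  qed
  then show "(\<lambda>i. if i = k then c else 0) \<in> lp p" "lp_norm p (\<lambda>i. if i = k then c else 0) \<le> norm c"
    using lp_boundedI[OF assms(1), of "\<lambda>i. if i = k then c else 0" "norm c"] assms(2) by auto
qed

text \<open>
  Separability, in the form of a sequence of finitely supported vectors that comes close to every
  vector at arbitrarily late times: enumerate the lists over a countable dense set of scalars, each
  of them infinitely often.
\<close>

lemma lp_finsupp_dense_sequence:
  assumes p: "1 \<le> p"
  obtains Y :: "nat \<Rightarrow> nat \<Rightarrow> 'a::{real_normed_field, euclidean_space}"
  where "\<And>j. Y j 0 = 0" and "\<And>j. finite {k. Y j k \<noteq> 0}"
    and "\<And>x e m. x \<in> lp p \<Longrightarrow> e > 0 \<Longrightarrow> \<exists>j\<ge>m. lp_norm p (\<lambda>k. x k - Y j k) < e"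
proof -
  have p0: "p > 0" using p by simp
  obtain Q :: "'a set" where Q: "countable Q" "\<And>U. open U \<Longrightarrow> U \<noteq> {} \<Longrightarrow> \<exists>d\<in>Q. d \<in> U"
    using countable_dense_setE by blast
  have "countable (lists Q)" "lists Q \<noteq> {}" using Q(1) by auto
  define vec :: "'a list \<Rightarrow> nat \<Rightarrow> 'a"
    where "vec xs k = (if 1 \<le> k \<and> k \<le> length xs then xs ! (k - 1) else 0)" for xs k
  define Y where "Y j = vec (from_nat_into (lists Q) (fst (prod_decode j)))" for j
  show ?thesis
  proof
    show "Y j 0 = 0" for j by (simp add: Y_def vec_def)
    show "finite {k. Y j k \<noteq> 0}" for j
      by (rule finite_subset[of _ "{..length (from_nat_into (lists Q) (fst (prod_decode j)))}"])
        (auto simp: Y_def vec_def split: if_splits)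
    fix x :: "nat \<Rightarrow> 'a" and e :: real and m :: nat
    assume x: "x \<in> lp p" and e: "e > 0"
    obtain L where L: "\<And>h :: nat \<Rightarrow> 'a. \<lbrakk>\<And>k. norm (h k) \<le> norm (x k); \<And>k. k < L \<Longrightarrow> h k = 0\<rbrakk> \<Longrightarrow> lp_norm p h < e / 2"
      using lp_tail[OF p x, of "e / 2"] e by auto
    have "\<exists>d\<in>Q. norm (x k - d) < e / (2 * (real L + 1))" for k
    proof -
      have "0 < e / (2 * (real L + 1))" using e by (intro divide_pos_pos) auto
      then have "ball (x k) (e / (2 * (real L + 1))) \<noteq> {}" by simp
      then show ?thesis using Q(2)[of "ball (x k) (e / (2 * (real L + 1)))"]
        by (auto simp: dist_norm)
    qed
    then obtain d where d: "\<And>k. d k \<in> Q" "\<And>k. norm (x k - d k) < e / (2 * (real L + 1))" by metis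
    define xs where "xs = map d [1..<Suc L]"
    have "xs \<in> lists Q" using d(1) by (auto simp: xs_def)
    then obtain i where i: "from_nat_into (lists Q) i = xs"
      using from_nat_into_surj[OF \<open>countable (lists Q)\<close>] by blast
    define j where "j = prod_encode (i, m)"
    have Yj: "Y j k = (if k \<in> {1..L} then d k else 0)" for k
      by (auto simp: Y_def j_def i vec_def xs_def nth_map_upt simp del: upt_Suc)
    have "j \<ge> m" by (simp add: j_def le_prod_encode_2)
    define h where "h k = (if k \<in> {1..L} then 0 else x k)" for k
    define u where "u i k = (if k = i then x i - d i else 0)" for i k :: nat
    have hx: "norm (h k) \<le> norm (x k)" for k by (simp add: h_def)
    have h: "h \<in> lp p" by (rule lp_dominated(1)[OF p0 x hx])
    have h_norm: "lp_norm p h < e / 2"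
      using lp_zero_index[OF x] by (intro L hx) (auto simp: h_def not_less_eq_eq)
    have u: "u i \<in> lp p" "lp_norm p (u i) \<le> e / (2 * (real L + 1))" if "i \<in> {1..L}" for i
    proof -
      have ui: "u i = (\<lambda>k. if k = i then x i - d i else 0)" by (simp add: u_def fun_eq_iff)
      have i: "i \<ge> 1" using that by simp
      show "u i \<in> lp p" "lp_norm p (u i) \<le> e / (2 * (real L + 1))"
        using single_in_lp[OF p0 i, of "x i - d i"] d(2)[of i] unfolding ui by linarith+
    qed
    have "lp_norm p (\<lambda>k. \<Sum>i\<in>{1..L}. u i k) \<le> (\<Sum>i\<in>{1..L}. lp_norm p (u i))"
      and us: "(\<lambda>k. \<Sum>i\<in>{1..L}. u i k) \<in> lp p"
      using lp_sum[OF p, of "{1..L}" u] u by auto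
    moreover have "(\<Sum>i\<in>{1..L}. lp_norm p (u i)) \<le> (\<Sum>i\<in>{1..L}. e / (2 * (real L + 1)))"
      by (rule sum_mono) (rule u)
    moreover have "(\<Sum>i\<in>{1..L}. e / (2 * (real L + 1))) \<le> e / 2"
      using e by (simp add: field_simps)
    ultimately have us_norm: "lp_norm p (\<lambda>k. \<Sum>i\<in>{1..L}. u i k) \<le> e / 2" by linarith
    have "x k - Y j k = h k + (\<Sum>i\<in>{1..L}. u i k)" for k
      by (simp add: Yj h_def u_def)
    then have "lp_norm p (\<lambda>k. x k - Y j k) \<le> lp_norm p h + lp_norm p (\<lambda>k. \<Sum>i\<in>{1..L}. u i k)"
      using lp_Minkowski[OF p h us] by simp
    then have "lp_norm p (\<lambda>k. x k - Y j k) < e" using h_norm us_norm by linarith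
    then show "\<exists>j\<ge>m. lp_norm p (\<lambda>k. x k - Y j k) < e" using \<open>j \<ge> m\<close> by blast
  qed
qed

text \<open>Necessary conditions only look at single coordinates, which the norm dominates.\<close>

lemma dense_in_lp_coordinates:
  assumes p: "1 \<le> p" and "dense_in (lp_topology p) S" and "v \<in> lp p" and "e > 0"
  obtains x where "x \<in> S" and "\<And>k. norm (v k - x k) < e"
proof -
  obtain x where x: "x \<in> S" "x \<in> lp p" "lp_norm p (\<lambda>k. v k - x k) < e"
    using assms by (auto simp: dense_in_lp_iff)
  have "norm (v k - x k) < e" for k
    using lp_coordinate_le[OF _ lp_diff[OF p assms(3) x(2)], of k] x(3) p by simp
  then show ?thesis using that x(1) by blast
qed

section \<open>Iterates of a pseudo-shift\<close>

definition orbit_weight :: "(nat \<Rightarrow> nat) \<Rightarrow> (nat \<Rightarrow> 'a::real_normed_field) \<Rightarrow> nat \<Rightarrow> nat \<Rightarrow> 'a" where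
  "orbit_weight \<phi> w n k = (\<Prod>j<n. w ((\<phi> ^^ j) k))"

lemma orbit_weight_0 [simp]: "orbit_weight \<phi> w 0 k = 1"
  by (simp add: orbit_weight_def)

lemma orbit_weight_Suc: "orbit_weight \<phi> w (Suc n) k = orbit_weight \<phi> w n k * w ((\<phi> ^^ n) k)"
  by (simp add: orbit_weight_def)

lemma orbit_weight_Suc_shift: "orbit_weight \<phi> w (Suc n) k = w k * orbit_weight \<phi> w n (\<phi> k)"
  unfolding orbit_weight_def prod.lessThan_Suc_shift by (simp add: funpow_swap1 del: prod.lessThan_Suc)

lemma iterate_ge_1:
  fixes \<phi> :: "nat \<Rightarrow> nat"
  assumes "\<phi> \<in> {1..} \<rightarrow> {1..}" and "k \<ge> 1"
  shows "(\<phi> ^^ n) k \<ge> 1"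
proof (induction n)
  case (Suc n)
  then have "(\<phi> ^^ n) k \<in> {1..}" by simp
  then have "\<phi> ((\<phi> ^^ n) k) \<in> {1..}" using assms(1) by blast
  then show ?case by simp
qed (use assms in simp)

lemma funpow_add_apply: "(f ^^ (m + n)) x = (f ^^ m) ((f ^^ n) x)"
  by (simp add: funpow_add)

lemma funpow_inj_on:
  fixes \<phi> :: "nat \<Rightarrow> nat"
  assumes "\<phi> \<in> {1..} \<rightarrow> {1..}" and "inj_on \<phi> {1..}"
    and "k \<ge> 1" and "l \<ge> 1" and "(\<phi> ^^ n) k = (\<phi> ^^ n) l"
  shows "k = l"
  using assms(5)
proof (induction n)
  case (Suc n)
  then show ?case
    using inj_onD[OF assms(2), of "(\<phi> ^^ n) k" "(\<phi> ^^ n) l"]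
      iterate_ge_1[OF assms(1,3), of n] iterate_ge_1[OF assms(1,4), of n] by simp
qed simp

lemma orbit_inj:
  assumes \<phi>: "\<phi> \<in> {1..} \<rightarrow> {1..}" and inj: "inj_on \<phi> {1..}"
    and nofix: "\<And>n k. n \<ge> 1 \<Longrightarrow> k \<ge> 1 \<Longrightarrow> (\<phi> ^^ n) k \<noteq> (k::nat)"
    and k: "k \<ge> 1" and eq: "(\<phi> ^^ m) k = (\<phi> ^^ n) k"
  shows "m = n"
proof -
  have "\<not> i < j" if e: "(\<phi> ^^ i) k = (\<phi> ^^ j) k" for i j
  proof
    assume "i < j"
    then have "(\<phi> ^^ i) k = (\<phi> ^^ i) ((\<phi> ^^ (j - i)) k)"
      using e funpow_add_apply[of i "j - i" \<phi> k] by simp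
    then have "k = (\<phi> ^^ (j - i)) k"
      using funpow_inj_on[OF \<phi> inj k iterate_ge_1[OF \<phi> k]] by blast
    moreover have "(\<phi> ^^ (j - i)) k \<noteq> k" using k \<open>i < j\<close> by (intro nofix) auto
    ultimately show False by metis
  qed
  then show ?thesis using eq by (metis linorder_neqE_nat)
qed

lemma neg_iterate_eq:
  assumes "\<phi> \<in> {1..} \<rightarrow> {1..}" and "inj_on \<phi> {1..}" and "l \<ge> 1" and "(\<phi> ^^ n) l = k"
  shows "neg_iterate \<phi> n k = l"
proof -
  have "(THE l. l \<ge> 1 \<and> (\<phi> ^^ n) l = k) = l"
    using assms funpow_inj_on[OF assms(1,2)] by (intro the_equality) auto
  then show ?thesis using assms(3,4) by (auto simp: neg_iterate_def)
qed

lemma prod_neg_iterate_eq: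
  assumes "\<phi> \<in> {1..} \<rightarrow> {1..}" and "inj_on \<phi> {1..}" and "l \<ge> 1" and "(\<phi> ^^ n) l = k"
  shows "(\<Prod>j=1..n. w (neg_iterate \<phi> j k)) = orbit_weight \<phi> w n l"
proof -
  have "neg_iterate \<phi> (Suc i) k = (\<phi> ^^ (n - Suc i)) l" if "i < n" for i
    using neg_iterate_eq[OF assms(1,2) iterate_ge_1[OF assms(1,3)], of "Suc i" "n - Suc i"]
      funpow_add_apply[of "Suc i" "n - Suc i" \<phi> l] that assms(4) by simp
  then have "(\<Prod>j=1..n. w (neg_iterate \<phi> j k)) = (\<Prod>i<n. w ((\<phi> ^^ (n - Suc i)) l))"
    by (simp add: prod.atLeast1_atMost_eq)
  also have "\<dots> = orbit_weight \<phi> w n l"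
    unfolding orbit_weight_def by (rule prod.nat_diff_reindex)
  finally show ?thesis .
qed

lemma neg_iterate_inverse:
  assumes "\<phi> \<in> {1..} \<rightarrow> {1..}" and "inj_on \<phi> {1..}" and "\<exists>l\<ge>1. (\<phi> ^^ n) l = k"
  shows "neg_iterate \<phi> n k \<ge> 1" and "(\<phi> ^^ n) (neg_iterate \<phi> n k) = k"
    and "(\<Prod>j=1..n. w (neg_iterate \<phi> j k)) = orbit_weight \<phi> w n (neg_iterate \<phi> n k)"
proof -
  obtain l where l: "l \<ge> 1" "(\<phi> ^^ n) l = k" using assms(3) by blast
  note eq = neg_iterate_eq[OF assms(1,2) l]
  show "neg_iterate \<phi> n k \<ge> 1" "(\<phi> ^^ n) (neg_iterate \<phi> n k) = k"
    unfolding eq by (rule l)+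
  show "(\<Prod>j=1..n. w (neg_iterate \<phi> j k)) = orbit_weight \<phi> w n (neg_iterate \<phi> n k)"
    unfolding eq by (rule prod_neg_iterate_eq[OF assms(1,2) l])
qed

lemma inj_on_neg_iterate:
  assumes "\<phi> \<in> {1..} \<rightarrow> {1..}" and "inj_on \<phi> {1..}"
    and "\<And>n k. n \<ge> 1 \<Longrightarrow> k \<ge> 1 \<Longrightarrow> (\<phi> ^^ n) k \<noteq> (k::nat)"
  shows "inj_on (\<lambda>n. neg_iterate \<phi> n k) {n. n \<ge> 1 \<and> (\<exists>l\<ge>1. (\<phi> ^^ n) l = k)}"
proof (rule inj_onI)
  fix m n
  assume mn: "m \<in> {n. n \<ge> 1 \<and> (\<exists>l\<ge>1. (\<phi> ^^ n) l = k)}" "n \<in> {n. n \<ge> 1 \<and> (\<exists>l\<ge>1. (\<phi> ^^ n) l = k)}"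
    and eq: "neg_iterate \<phi> m k = neg_iterate \<phi> n k"
  have m: "\<exists>l\<ge>1. (\<phi> ^^ m) l = k" and n: "\<exists>l\<ge>1. (\<phi> ^^ n) l = k" using mn by auto
  have "(\<phi> ^^ m) (neg_iterate \<phi> n k) = (\<phi> ^^ n) (neg_iterate \<phi> n k)"
    using neg_iterate_inverse(2)[OF assms(1,2) m] neg_iterate_inverse(2)[OF assms(1,2) n] eq by simp
  then show "m = n"
    using orbit_inj[OF assms neg_iterate_inverse(1)[OF assms(1,2) n]] by blast
qed

lemma prod_neg_iterate_eq_0:
  assumes "w 0 = 0" and "n \<ge> 1" and "\<not> (\<exists>l\<ge>1. (\<phi> ^^ n) l = k)"
  shows "(\<Prod>j=1..n. w (neg_iterate \<phi> j k)) = (0::'a::real_normed_field)"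
  using assms by (intro prod_zero) (auto simp: neg_iterate_def intro!: bexI[of _ n])

locale lp_pseudo_shift =
  fixes p :: real and \<phi> :: "nat \<Rightarrow> nat" and w :: "nat \<Rightarrow> 'a::{real_normed_field, euclidean_space}"
  assumes p: "1 \<le> p" and \<phi>: "\<phi> \<in> {1..} \<rightarrow> {1..}"
begin

abbreviation "T \<equiv> pseudo_shift \<phi> w"
abbreviation "D \<equiv> pseudo_shift_domain p \<phi> w"
abbreviation "W \<equiv> orbit_weight \<phi> w"

lemma p_pos: "p > 0" using p by simp

lemma T_funpow: "k \<ge> 1 \<Longrightarrow> (T ^^ n) x k = W n k * x ((\<phi> ^^ n) k)"
  by (simp add: pseudo_shift_funpow[OF \<phi>] orbit_weight_def)

section \<open>Chaos forces the three conditions\<close>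

text \<open>
  A dense orbit cannot satisfy a nontrivial linear relation between two coordinates from its second
  term on: apart from the value at the first term, the corresponding functional would vanish on it.
\<close>

lemma dense_orbit_no_relation:
  assumes dense: "dense_in (lp_topology p) (range (\<lambda>n. (T ^^ n) f))"
    and kl: "k \<ge> 1" "l \<ge> 1" "k \<noteq> l" and rel: "\<And>x. a * T x k + b * T x l = 0"
  shows "a = 0 \<and> b = 0"
proof (rule ccontr)
  assume ab: "\<not> (a = 0 \<and> b = 0)"
  define F where "F x = a * x k + b * x l" for x :: "nat \<Rightarrow> 'a"
  obtain i where i: "i \<in> {k, l}" and c: "F (\<lambda>j. if j = i then 1 else 0) \<noteq> 0"
  proof (cases "a = 0")
    case True
    then show ?thesis using that[of l] ab kl by (auto simp: F_def)
  next
    case False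
    then show ?thesis using that[of k] kl by (auto simp: F_def)
  qed
  define c where "c = F (\<lambda>j. if j = i then 1 else 0)"
  have F_single: "F (\<lambda>j. if j = i then t else 0) = t * c" for t
    using i kl by (auto simp: F_def c_def)
  \<comment> \<open>One of the values \<open>c\<close> and \<open>2 c\<close> differs from both values that the functional takes on the orbit.\<close>
  obtain t :: 'a where t: "t * c \<noteq> 0" "t * c \<noteq> F f"
  proof (cases "c = F f")
    case True
    then show ?thesis using that[of 2] c by (simp add: c_def)
  next
    case False
    then show ?thesis using that[of 1] c by (simp add: c_def)
  qed
  define e where "e = min (norm (t * c)) (norm (t * c - F f)) / (norm a + norm b)"
  have ab_pos: "norm a + norm b > 0" using ab by (auto simp: add_nonneg_eq_0_iff less_le)
  have e: "e > 0" using t ab_pos by (auto simp: e_def)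
  have "(\<lambda>j. if j = i then t else 0) \<in> lp p"
    using single_in_lp(1)[OF p_pos, of i t] i kl by auto
  then obtain x where x: "x \<in> range (\<lambda>n. (T ^^ n) f)" "\<And>j. norm ((if j = i then t else 0) - x j) < e"
    using dense_in_lp_coordinates[OF p dense _ e] by blast
  then obtain n where n: "x = (T ^^ n) f" by blast
  have "F x = 0 \<or> F x = F f"
  proof (cases n)
    case (Suc m)
    then show ?thesis using rel[of "(T ^^ m) f"] by (simp add: n F_def)
  qed (simp add: n)
  then have far: "min (norm (t * c)) (norm (t * c - F f)) \<le> norm (t * c - F x)" by auto
  have "norm (t * c - F x) = norm (a * ((if k = i then t else 0) - x k) + b * ((if l = i then t else 0) - x l))"
    unfolding F_single[symmetric] by (simp add: F_def algebra_simps)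
  also have "\<dots> \<le> norm a * norm ((if k = i then t else 0) - x k) + norm b * norm ((if l = i then t else 0) - x l)"
    by (rule norm_triangle_le) (simp add: norm_mult)
  also have "\<dots> < (norm a + norm b) * e"
  proof (cases "a = 0")
    case True
    then show ?thesis using x(2)[of l] ab by simp
  next
    case False
    then have "norm a * norm ((if k = i then t else 0) - x k) < norm a * e"
      using x(2)[of k] by (intro mult_strict_left_mono) auto
    moreover have "norm b * norm ((if l = i then t else 0) - x l) \<le> norm b * e"
      using x(2)[of l] by (intro mult_left_mono) auto
    ultimately show ?thesis by (simp only: distrib_right)
  qed
  also have "\<dots> = min (norm (t * c)) (norm (t * c - F f))" using ab_pos by (simp add: e_def)
  finally show False using far by linarith
qed

lemma dense_orbit_weight_nonzero:
  assumes "dense_in (lp_topology p) (range (\<lambda>n. (T ^^ n) f))" and "k \<ge> 1"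
  shows "w k \<noteq> 0"
  using dense_orbit_no_relation[OF assms(1), of k "Suc k" 1 0] assms(2)
  by (auto simp: pseudo_shift_def)

text \<open>If \<open>\<phi>\<close> identifies \<open>k\<close> and \<open>l\<close>, the coordinates \<open>k\<close> and \<open>l\<close> of every image are proportional.\<close>

lemma dense_orbit_inj_on:
  assumes "dense_in (lp_topology p) (range (\<lambda>n. (T ^^ n) f))"
  shows "inj_on \<phi> {1..}"
proof (rule inj_onI, rule ccontr)
  fix k l
  assume kl: "k \<in> {1..}" "l \<in> {1..}" "\<phi> k = \<phi> l" "k \<noteq> l"
  have "w l * T x k + (- w k) * T x l = 0" for x
    using kl by (simp add: pseudo_shift_def)
  then have "w l = 0" using dense_orbit_no_relation[OF assms, of k l "w l" "- w k"] kl by auto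
  then show False using dense_orbit_weight_nonzero[OF assms, of l] kl by auto
qed

text \<open>
  At a point \<open>k\<close> fixed by \<open>\<phi>\<^sup>n\<close>, the operator \<open>T\<^sup>n\<close> multiplies the \<open>k\<close>-th coordinate by a constant \<open>c\<close>.
  So that coordinate stays bounded along the orbit if \<open>\<bar>c\<bar> \<le> 1\<close>, and stays away from \<open>0\<close>, when it is
  not \<open>0\<close>, if \<open>\<bar>c\<bar> > 1\<close>.
\<close>

lemma dense_orbit_no_fixed_point:
  assumes dense: "dense_in (lp_topology p) (range (\<lambda>n. (T ^^ n) f))" and n: "n \<ge> 1" and k: "k \<ge> 1"
  shows "(\<phi> ^^ n) k \<noteq> k"
proof
  assume fixed: "(\<phi> ^^ n) k = k"
  define c where "c = W n k"
  define a where "a r = norm ((T ^^ r) f k)" for r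
  have step: "(T ^^ (j * n)) x k = c ^ j * x k" for j x
  proof (induction j)
    case (Suc j)
    have "(T ^^ (Suc j * n)) x k = (T ^^ n) ((T ^^ (j * n)) x) k"
      using funpow_add_apply[of n "j * n" T x] by (simp add: add.commute)
    then show ?case using Suc T_funpow[OF k, of n] fixed by (simp add: c_def)
  qed simp
  have orbit: "a m = norm c ^ (m div n) * a (m mod n)" for m
  proof -
    have "(T ^^ m) f = (T ^^ (m div n * n)) ((T ^^ (m mod n)) f)"
      using funpow_add_apply[of "m div n * n" "m mod n" T f] by simp
    then show ?thesis by (simp add: a_def step norm_mult norm_power)
  qed
  have approx: "\<exists>m. \<bar>s - a m\<bar> < e" if "s > 0" "e > 0" for s e
  proof -
    have "(\<lambda>j. if j = k then of_real s else 0) \<in> lp p" by (rule single_in_lp[OF p_pos k])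
    then obtain x where x: "x \<in> range (\<lambda>n. (T ^^ n) f)" "\<And>j. norm ((if j = k then of_real s else 0) - x j) < e"
      using dense_in_lp_coordinates[OF p dense _ \<open>e > 0\<close>] by blast
    then obtain m where "x = (T ^^ m) f" by blast
    then have "norm (of_real s - (T ^^ m) f k) < e" using x(2)[of k] by simp
    then have "\<bar>norm (of_real s :: 'a) - a m\<bar> < e"
      unfolding a_def using norm_triangle_ineq3 by (rule le_less_trans[rotated])
    then show ?thesis using that by auto
  qed
  show False
  proof (cases "norm c \<le> 1")
    case True
    define M where "M = (\<Sum>r<n. a r)"
    have "M \<ge> 0" by (auto simp: M_def a_def intro: sum_nonneg)
    have "a m \<le> M" for m
    proof -
      have "a m \<le> 1 * a (m mod n)"
        unfolding orbit[of m] using True by (intro mult_right_mono power_le_one) (auto simp: a_def)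
      also have "1 * a (m mod n) \<le> M"
        using n by (auto simp: M_def a_def intro: member_le_sum)
      finally show ?thesis .
    qed
    moreover obtain m where "\<bar>(M + 2) - a m\<bar> < 1" using approx[of "M + 2" 1] \<open>M \<ge> 0\<close> by auto
    ultimately show False by (smt (verit))
  next
    case False
    define \<delta> where "\<delta> = Min (insert 1 (a ` {..<n} - {0}))"
    have fin: "finite (insert 1 (a ` {..<n} - {0}))" by simp
    have "\<delta> > 0" unfolding \<delta>_def by (subst Min_gr_iff[OF fin]) (auto simp: a_def)
    have "a m = 0 \<or> \<delta> \<le> a m" for m
    proof (cases "a (m mod n) = 0")
      case True
      then show ?thesis by (simp add: orbit[of m])
    next
      case nz: False
      have "m mod n < n" using n by simp
      then have "\<delta> \<le> a (m mod n)" unfolding \<delta>_def using nz by (intro Min_le[OF fin]) auto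
      also have "\<dots> = 1 * a (m mod n)" by simp
      also have "\<dots> \<le> a m" unfolding orbit[of m]
        using False by (intro mult_right_mono one_le_power) (auto simp: a_def)
      finally show ?thesis by simp
    qed
    moreover obtain m where m: "\<bar>\<delta> / 2 - a m\<bar> < \<delta> / 4"
      using approx[of "\<delta> / 2" "\<delta> / 4"] \<open>\<delta> > 0\<close> by auto
    ultimately consider "a m = 0" | "\<delta> \<le> a m" by blast
    then show False using m \<open>\<delta> > 0\<close> by cases linarith+
  qed
qed

text \<open>
  A periodic vector \<open>x\<close> of period \<open>N\<close> controls both series at every \<open>k\<close> with \<open>x\<^sub>k \<noteq> 0\<close>. Its orbit
  consists of \<open>N\<close> vectors of \<open>\<ell>\<^sup>p\<close>, so the sum \<open>G l\<close> of the \<open>p\<close>-th powers of their \<open>l\<close>-th coordinates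
  is summable. Writing \<open>x = T\<^sup>n (T\<^sup>q x)\<close> for a suitable \<open>q < N\<close> gives
  \<open>x\<^sub>k = w\<^sub>k \<cdots> w\<^bsub>\<phi>\<^sup>n\<^sup>-\<^sup>1(k)\<^esub> (T\<^sup>q x)\<^bsub>\<phi>\<^sup>n(k)\<^esub>\<close>, and reading \<open>T\<^sup>n x\<close> at \<open>\<phi>\<^sup>-\<^sup>n(k)\<close> gives the mirror image.
  Both times \<open>G\<close> is summed over distinct indices.
\<close>

lemma periodic_vector_summability:
  assumes inj: "inj_on \<phi> {1..}"
    and nofix: "\<And>n k. n \<ge> 1 \<Longrightarrow> k \<ge> 1 \<Longrightarrow> (\<phi> ^^ n) k \<noteq> k"
    and w0: "w 0 = 0"
    and x: "x \<in> periodic_points D T" and k: "k \<ge> 1" and xk: "x k \<noteq> 0"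
  shows "W n k \<noteq> 0"
    and "(\<lambda>n. 1 / norm (W n k) powr p) summable_on {1..}"
    and "(\<lambda>n. norm (\<Prod>j=1..n. w (neg_iterate \<phi> j k)) powr p) summable_on {1..}"
proof -
  obtain N where N: "N \<ge> 1" "x \<in> power_domain D T N" "(T ^^ N) x = x"
    using x by (auto simp: periodic_points_def)
  have lp: "(T ^^ q) x \<in> lp p" if "q < N" for q
    using N(2) that by (auto simp: power_domain_def pseudo_shift_domain_def)
  have periodic: "(T ^^ (m mod N)) x = (T ^^ m) x" for m by (rule funpow_mod_eq[OF N(3)])
  define G where "G l = (\<Sum>q<N. norm ((T ^^ q) x l) powr p)" for l
  have "summable G" unfolding G_def by (intro summable_sum lp_summable lp) simp
  then have G: "G summable_on UNIV"
    by (subst summable_on_UNIV_nonneg_real_iff) (auto simp: G_def intro: sum_nonneg)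
  have G_ge: "norm ((T ^^ m) x l) powr p \<le> G l" for m l
  proof -
    have "norm ((T ^^ (m mod N)) x l) powr p \<le> G l"
      unfolding G_def using N(1) by (intro member_le_sum) auto
    then show ?thesis by (simp only: periodic)
  qed
  have forward: "x k = W n k * (T ^^ (n * (N - 1))) x ((\<phi> ^^ n) k)" for n
  proof -
    have "x = (T ^^ (n * N mod N)) x" by simp
    also have "\<dots> = (T ^^ (n * N)) x" by (rule periodic)
    also have "n * N = n + n * (N - 1)" using N(1) by (cases N) auto
    also have "(T ^^ (n + n * (N - 1))) x = (T ^^ n) ((T ^^ (n * (N - 1))) x)"
      by (rule funpow_add_apply)
    finally have "x k = (T ^^ n) ((T ^^ (n * (N - 1))) x) k" by (rule fun_cong)
    then show ?thesis by (simp only: T_funpow[OF k])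
  qed
  show W: "W n k \<noteq> 0" for n using forward[of n] xk by auto
  have orbit_inj': "inj_on (\<lambda>n. (\<phi> ^^ n) l) A" if "l \<ge> 1" for l A
    using orbit_inj[OF \<phi> inj nofix that] by (auto intro: inj_onI)
  have "(\<lambda>n. G ((\<phi> ^^ n) k)) summable_on {1..}"
    using summable_on_reindex[OF orbit_inj'[OF k, of "{1..}"], of G]
      summable_on_subset_banach[OF G] by (simp add: o_def)
  then have "(\<lambda>n. G ((\<phi> ^^ n) k) * (1 / norm (x k) powr p)) summable_on {1..}"
    by (rule summable_on_cmult_left)
  moreover have "1 / norm (W n k) powr p \<le> G ((\<phi> ^^ n) k) * (1 / norm (x k) powr p)" for n
  proof -
    have "norm (x k) powr p = norm (W n k) powr p * norm ((T ^^ (n * (N - 1))) x ((\<phi> ^^ n) k)) powr p"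
      using forward[of n] by (metis norm_mult powr_mult norm_ge_zero)
    also have "\<dots> \<le> norm (W n k) powr p * G ((\<phi> ^^ n) k)"
      by (intro mult_left_mono G_ge) simp
    finally show ?thesis using W[of n] xk by (simp add: field_simps)
  qed
  ultimately show "(\<lambda>n. 1 / norm (W n k) powr p) summable_on {1..}"
    by (rule summable_on_comparison_test) auto
  define E where "E = {n. n \<ge> 1 \<and> (\<exists>l\<ge>1. (\<phi> ^^ n) l = k)}"
  have E: "neg_iterate \<phi> n k \<ge> 1 \<and> (\<phi> ^^ n) (neg_iterate \<phi> n k) = k
      \<and> (\<Prod>j=1..n. w (neg_iterate \<phi> j k)) = W n (neg_iterate \<phi> n k)" if "n \<in> E" for n
    using that neg_iterate_inverse[OF \<phi> inj, of n k] by (simp add: E_def)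
  have inj_E: "inj_on (\<lambda>n. neg_iterate \<phi> n k) E"
    unfolding E_def by (rule inj_on_neg_iterate[OF \<phi> inj nofix])
  have "(\<lambda>n. G (neg_iterate \<phi> n k)) summable_on E"
    using summable_on_reindex[OF inj_E, of G] summable_on_subset_banach[OF G] by (simp add: o_def)
  then have "(\<lambda>n. G (neg_iterate \<phi> n k) * (1 / norm (x k) powr p)) summable_on E"
    by (rule summable_on_cmult_left)
  moreover have "norm (\<Prod>j=1..n. w (neg_iterate \<phi> j k)) powr p \<le> G (neg_iterate \<phi> n k) * (1 / norm (x k) powr p)"
    if "n \<in> E" for n
  proof -
    have "norm ((T ^^ n) x (neg_iterate \<phi> n k)) = norm (\<Prod>j=1..n. w (neg_iterate \<phi> j k)) * norm (x k)"
      using E[OF that] T_funpow[of "neg_iterate \<phi> n k" n x] by (simp add: norm_mult)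
    then have "norm (\<Prod>j=1..n. w (neg_iterate \<phi> j k)) powr p * norm (x k) powr p \<le> G (neg_iterate \<phi> n k)"
      using G_ge[of n "neg_iterate \<phi> n k"] by (simp add: powr_mult)
    then show ?thesis using xk by (simp add: field_simps)
  qed
  ultimately have "(\<lambda>n. norm (\<Prod>j=1..n. w (neg_iterate \<phi> j k)) powr p) summable_on E"
    by (rule summable_on_comparison_test) auto
  moreover have "norm (\<Prod>j=1..n. w (neg_iterate \<phi> j k)) powr p = 0" if "n \<in> {1..} - E" for n
    using prod_neg_iterate_eq_0[of w n \<phi> k, OF w0] that p_pos by (auto simp: E_def simp del: prod_zero_iff)
  ultimately show "(\<lambda>n. norm (\<Prod>j=1..n. w (neg_iterate \<phi> j k)) powr p) summable_on {1..}"
    by (subst summable_on_cong_neutral[of E]) (auto simp: E_def)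
qed

end

section \<open>Vectors along a full orbit\<close>

text \<open>The index \<open>l\<close> sits at position \<open>i\<close> of the two-sided orbit of \<open>k\<close>, that is \<open>l = \<phi>\<^sup>i(k)\<close>, with
  negative exponents read as preimages.\<close>

definition at_position :: "(nat \<Rightarrow> nat) \<Rightarrow> nat \<Rightarrow> int \<Rightarrow> nat \<Rightarrow> bool" where
  "at_position \<phi> k i l \<longleftrightarrow> l \<ge> 1 \<and> (\<phi> ^^ nat (- i)) l = (\<phi> ^^ nat i) k"

text \<open>
  For \<open>A = UNIV\<close> this is the formal fixed vector of the operator \<open>T\<close> whose support is the orbit of \<open>k\<close>
  and whose \<open>k\<close>-th coordinate is \<open>1\<close>; in general it is the part of that vector at the positions in
  \<open>A\<close>. For singletons one gets \<open>e\<^sub>k\<close> at position \<open>0\<close>, the images \<open>T\<^sup>n e\<^sub>k\<close> at position \<open>- n\<close>, and their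
  counterparts under the right inverse \<open>e\<^sub>k \<mapsto> e\<^bsub>\<phi>(k)\<^esub> / w\<^sub>k\<close> at position \<open>n\<close>. If \<open>\<phi>\<close> is injective
  without periodic points, positions are unique and the sum has at most one term; at the index \<open>0\<close>
  it is empty.
\<close>

definition orbit_part :: "(nat \<Rightarrow> nat) \<Rightarrow> (nat \<Rightarrow> 'a::real_normed_field) \<Rightarrow> nat \<Rightarrow> int set \<Rightarrow> nat \<Rightarrow> 'a" where
  "orbit_part \<phi> w k A l = (\<Sum>i | i \<in> A \<and> at_position \<phi> k i l.
     orbit_weight \<phi> w (nat (- i)) l / orbit_weight \<phi> w (nat i) k)"

definition combined_orbit_part ::
    "(nat \<Rightarrow> nat) \<Rightarrow> (nat \<Rightarrow> 'a::real_normed_field) \<Rightarrow> (nat \<Rightarrow> 'a) \<Rightarrow> int set \<Rightarrow> nat \<Rightarrow> 'a" where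
  "combined_orbit_part \<phi> w y A l = (\<Sum>k | y k \<noteq> 0. y k * orbit_part \<phi> w k A l)"

text \<open>
  Finiteness of the first series is split into its two parts, nonzero weights and summability of real
  numbers.
\<close>

locale summable_pseudo_shift = lp_pseudo_shift +
  assumes inj: "inj_on \<phi> {1..}"
    and nofix: "\<And>n k. n \<ge> 1 \<Longrightarrow> k \<ge> 1 \<Longrightarrow> (\<phi> ^^ n) k \<noteq> k"
    and nonzero: "\<And>k. k \<ge> 1 \<Longrightarrow> w k \<noteq> 0"
    and forward: "\<And>k. k \<ge> 1 \<Longrightarrow> (\<lambda>n. 1 / norm (W n k) powr p) summable_on {1..}"
    and backward: "\<And>k. k \<ge> 1 \<Longrightarrow>
      (\<lambda>n. norm (\<Prod>j=1..n. w (neg_iterate \<phi> j k)) powr p) summable_on {1..}"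
begin

abbreviation "at_pos \<equiv> at_position \<phi>"
abbreviation "opart \<equiv> orbit_part \<phi> w"
abbreviation "cpart \<equiv> combined_orbit_part \<phi> w"

lemma W_nonzero: "k \<ge> 1 \<Longrightarrow> W n k \<noteq> 0"
  using nonzero iterate_ge_1[OF \<phi>, of k] by (auto simp: orbit_weight_def)

lemma at_position_unique:
  assumes "k \<ge> 1" and i: "at_pos k i l" and j: "at_pos k j l"
  shows "i = j"
proof -
  let ?a = "nat (- i)" and ?b = "nat i" and ?c = "nat (- j)" and ?d = "nat j"
  have l: "l \<ge> 1" using i by (simp add: at_position_def)
  have "(\<phi> ^^ (?d + ?a)) l = (\<phi> ^^ (?d + ?b)) k"
    using i by (simp add: funpow_add_apply at_position_def)
  also have "\<dots> = (\<phi> ^^ (?b + ?d)) k" by (simp only: add.commute)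
  also have "\<dots> = (\<phi> ^^ (?b + ?c)) l"
    using j by (simp add: funpow_add_apply at_position_def)
  finally have "?d + ?a = ?b + ?c" using orbit_inj[OF \<phi> inj nofix l] by blast
  then show ?thesis by linarith
qed

lemma positions_eq_singleton:
  assumes "k \<ge> 1" and "at_pos k i l"
  shows "{j. j \<in> A \<and> at_pos k j l} = (if i \<in> A then {i} else {})"
proof -
  have "at_pos k j l \<longleftrightarrow> j = i" for j
    using at_position_unique[OF assms, of j] assms(2) by blast
  then show ?thesis by auto
qed

lemma orbit_part_at:
  assumes "k \<ge> 1" and "at_pos k i l"
  shows "opart k A l = (if i \<in> A then W (nat (- i)) l / W (nat i) k else 0)"
  unfolding orbit_part_def positions_eq_singleton[OF assms] by simp

lemma orbit_part_off: "(\<And>i. \<not> at_pos k i l) \<Longrightarrow> opart k A l = 0"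
  by (simp add: orbit_part_def)

lemma orbit_part_zero_index: "opart k A 0 = 0"
  by (rule orbit_part_off) (simp add: at_position_def)

lemma at_position_step:
  assumes "k \<ge> 1" and "l \<ge> 1"
  shows "at_pos k i (\<phi> l) \<longleftrightarrow> at_pos k (i - 1) l"
proof (cases "i \<ge> 1")
  case True
  then have n: "nat i = Suc (nat (i - 1))" by simp
  have "\<phi> l = \<phi> ((\<phi> ^^ nat (i - 1)) k) \<longleftrightarrow> l = (\<phi> ^^ nat (i - 1)) k"
    using inj_on_eq_iff[OF inj, of l] assms iterate_ge_1[OF \<phi> assms(1)] by simp
  then show ?thesis
    using True assms iterate_ge_1[OF \<phi> assms(2), of 1] by (simp add: at_position_def n)
next
  case False
  then have n: "nat (- (i - 1)) = Suc (nat (- i))" and "nat i = 0" "nat (i - 1) = 0" by auto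
  then show ?thesis
    using assms iterate_ge_1[OF \<phi> assms(2), of 1] by (simp add: at_position_def n funpow_swap1)
qed

text \<open>The operator moves the part of the fixed vector at the positions in \<open>A\<close> one position back.\<close>

lemma T_orbit_part:
  assumes k: "k \<ge> 1"
  shows "T (opart k A) = opart k {i. i + 1 \<in> A}"
proof
  fix l
  show "T (opart k A) l = opart k {i. i + 1 \<in> A} l"
  proof (cases "l = 0 \<or> (\<forall>i. \<not> at_pos k i l)")
    case True
    then show ?thesis
    proof
      assume "\<forall>i. \<not> at_pos k i l"
      moreover from this have "\<not> at_pos k i (\<phi> l)" if "l \<noteq> 0" for i
        using at_position_step[OF k, of l i] that by simp
      ultimately show ?thesis by (simp add: pseudo_shift_def orbit_part_off)
    qed (simp add: pseudo_shift_def orbit_part_zero_index)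
  next
    case False
    then obtain i where i: "at_pos k i l" and l: "l \<ge> 1" by auto
    have i': "at_pos k (i + 1) (\<phi> l)" using at_position_step[OF k l, of "i + 1"] i by simp
    have "w l * (W (nat (- (i + 1))) (\<phi> l) / W (nat (i + 1)) k) = W (nat (- i)) l / W (nat i) k"
    proof (cases "i \<ge> 0")
      case True
      then have "nat (i + 1) = Suc (nat i)" "l = (\<phi> ^^ nat i) k"
        using i by (auto simp: at_position_def)
      then show ?thesis using True W_nonzero[OF k] nonzero[OF l]
        by (simp add: orbit_weight_Suc)
    next
      case False
      then have "nat (- i) = Suc (nat (- (i + 1)))" "nat (i + 1) = 0" "nat i = 0" by auto
      then show ?thesis by (simp add: orbit_weight_Suc_shift)
    qed
    then show ?thesis
      using l by (simp add: pseudo_shift_def orbit_part_at[OF k i] orbit_part_at[OF k i'])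
  qed
qed

text \<open>
  The positions \<open>i \<ge> 0\<close> contribute the first series at \<open>k\<close>, the positions \<open>i < 0\<close> the second one; no
  index is visited twice, as \<open>\<phi>\<close> has no periodic points.
\<close>

lemma orbit_part_UNIV_in_lp:
  assumes k: "k \<ge> 1"
  shows "opart k UNIV \<in> lp p"
proof -
  define g where "g l = norm (opart k UNIV l) powr p" for l
  have at_forward: "at_pos k (int n) ((\<phi> ^^ n) k)" for n
    using iterate_ge_1[OF \<phi> k] by (simp add: at_position_def)
  have inj_F: "inj_on (\<lambda>n. (\<phi> ^^ n) k) {1..}"
    using orbit_inj[OF \<phi> inj nofix k] by (auto intro: inj_onI)
  have "g ((\<phi> ^^ n) k) = 1 / norm (W n k) powr p" for n
    using orbit_part_at[OF k at_forward, of UNIV n]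
    by (cases "n = 0") (simp_all add: g_def norm_divide powr_divide)
  then have F: "g summable_on ((\<lambda>n. (\<phi> ^^ n) k) ` {1..})"
    using forward[OF k] by (subst summable_on_reindex[OF inj_F]) (simp add: o_def)
  define E where "E = {n. n \<ge> 1 \<and> (\<exists>l\<ge>1. (\<phi> ^^ n) l = k)}"
  have E: "neg_iterate \<phi> n k \<ge> 1 \<and> (\<phi> ^^ n) (neg_iterate \<phi> n k) = k
      \<and> (\<Prod>j=1..n. w (neg_iterate \<phi> j k)) = W n (neg_iterate \<phi> n k)" if "n \<in> E" for n
    using that neg_iterate_inverse[OF \<phi> inj, of n k] by (simp add: E_def)
  have inj_E: "inj_on (\<lambda>n. neg_iterate \<phi> n k) E"
    unfolding E_def by (rule inj_on_neg_iterate[OF \<phi> inj nofix])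
  have "g (neg_iterate \<phi> n k) = norm (\<Prod>j=1..n. w (neg_iterate \<phi> j k)) powr p" if "n \<in> E" for n
  proof -
    have "at_pos k (- int n) (neg_iterate \<phi> n k)" using E[OF that] by (simp add: at_position_def)
    then show ?thesis using orbit_part_at[OF k, of "- int n" _ UNIV] E[OF that] by (simp add: g_def)
  qed
  moreover have "(\<lambda>n. norm (\<Prod>j=1..n. w (neg_iterate \<phi> j k)) powr p) summable_on E"
    by (rule summable_on_subset_banach[OF backward[OF k]]) (auto simp: E_def)
  ultimately have "g summable_on ((\<lambda>n. neg_iterate \<phi> n k) ` E)"
    by (subst summable_on_reindex[OF inj_E]) (simp add: o_def cong: summable_on_cong)
  with F have U: "g summable_on ((\<lambda>n. (\<phi> ^^ n) k) ` {1..} \<union> (\<lambda>n. neg_iterate \<phi> n k) ` E \<union> {k})"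
    by (intro summable_on_union) auto
  have "g l = 0" if l: "l \<notin> (\<lambda>n. (\<phi> ^^ n) k) ` {1..} \<union> (\<lambda>n. neg_iterate \<phi> n k) ` E \<union> {k}" for l
  proof -
    have "\<not> at_pos k i l" for i
    proof
      assume i: "at_pos k i l"
      consider "i = 0" | "i \<ge> 1" | "i < 0" by linarith
      then show False
      proof cases
        case 2
        then have "l = (\<phi> ^^ nat i) k" "nat i \<in> {1..}" using i by (auto simp: at_position_def)
        then show False using l by blast
      next
        case 3
        then have "l \<ge> 1" "(\<phi> ^^ nat (- i)) l = k" using i by (auto simp: at_position_def)
        then have "nat (- i) \<in> E" "l = neg_iterate \<phi> (nat (- i)) k"
          using 3 neg_iterate_eq[OF \<phi> inj, of l "nat (- i)" k] by (auto simp: E_def)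
        then show False using l by blast
      qed (use i l in \<open>auto simp: at_position_def\<close>)
    qed
    then show ?thesis using p_pos by (simp add: g_def orbit_part_off)
  qed
  with U have "g summable_on UNIV" by (subst summable_on_cong_neutral) auto
  then have "summable g" by (subst (asm) summable_on_UNIV_nonneg_real_iff) (auto simp: g_def)
  then show ?thesis by (simp add: lp_def g_def[abs_def] orbit_part_zero_index)
qed

lemma orbit_part_norm_le:
  assumes "k \<ge> 1"
  shows "norm (opart k A l) \<le> norm (opart k UNIV l)"
proof (cases "\<exists>i. at_pos k i l")
  case True
  then show ?thesis using orbit_part_at[OF assms] by auto
qed (simp add: orbit_part_off)

lemma orbit_part_in_lp: "k \<ge> 1 \<Longrightarrow> opart k A \<in> lp p"
  by (rule lp_dominated(1)[OF p_pos orbit_part_UNIV_in_lp orbit_part_norm_le])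

text \<open>
  Any initial segment of indices meets only finitely many positions of the orbit, so positions far
  from \<open>0\<close> belong to the tail of the fixed vector.
\<close>

lemma orbit_part_far:
  assumes k: "k \<ge> 1" and e: "e > 0"
  shows "\<exists>M. \<forall>A. (\<forall>i\<in>A. \<bar>i\<bar> \<ge> M) \<longrightarrow> lp_norm p (opart k A) < e"
proof -
  obtain L where L: "\<And>h :: nat \<Rightarrow> 'a. \<lbrakk>\<And>l. norm (h l) \<le> norm (opart k UNIV l); \<And>l. l < L \<Longrightarrow> h l = 0\<rbrakk>
      \<Longrightarrow> lp_norm p h < e"
    using lp_tail[OF p orbit_part_UNIV_in_lp[OF k] e] by auto
  have "finite {i. at_pos k i l}" for l
  proof (cases "\<exists>i. at_pos k i l")
    case True
    then show ?thesis using positions_eq_singleton[OF k, of _ l UNIV] by auto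
  qed simp
  then have "finite (\<Union>l<L. {i. at_pos k i l})" by blast
  then obtain M where M0: "abs ` (\<Union>l<L. {i. at_pos k i l}) \<subseteq> {..<M}"
    unfolding finite_int_iff_bounded by blast
  have M: "\<bar>i\<bar> < M" if "l < L" "at_pos k i l" for i l using M0 that by blast
  have "lp_norm p (opart k A) < e" if "\<forall>i\<in>A. \<bar>i\<bar> \<ge> M" for A
  proof (rule L)
    show "opart k A l = 0" if "l < L" for l
    proof (cases "\<exists>i. at_pos k i l")
      case True
      then obtain i where i: "at_pos k i l" by blast
      then have "i \<notin> A" using M[OF that i] \<open>\<forall>i\<in>A. \<bar>i\<bar> \<ge> M\<close> by force
      then show ?thesis by (simp add: orbit_part_at[OF k i])
    qed (simp add: orbit_part_off)
  qed (rule orbit_part_norm_le[OF k])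
  then show ?thesis by blast
qed

lemma orbit_part_Un:
  assumes "k \<ge> 1" and "A \<inter> B = {}"
  shows "opart k (A \<union> B) l = opart k A l + opart k B l"
proof (cases "\<exists>i. at_pos k i l")
  case True
  then obtain i where i: "at_pos k i l" by blast
  then show ?thesis using assms(2) by (auto simp: orbit_part_at[OF assms(1) i])
qed (simp add: orbit_part_off)

lemma orbit_part_0:
  assumes "k \<ge> 1"
  shows "opart k {0} l = (if l = k then 1 else 0)"
proof (cases "l = k")
  case True
  then have "at_pos k 0 l" using assms by (simp add: at_position_def)
  then show ?thesis using True orbit_part_at[OF assms, of 0] by simp
next
  case False
  then have "{i. i \<in> {0} \<and> at_pos k i l} = {}" by (auto simp: at_position_def)
  then show ?thesis using False by (simp only: orbit_part_def) simp
qed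

section \<open>Finite combinations of orbit vectors\<close>

definition finsupp :: "(nat \<Rightarrow> 'a) set" where
  "finsupp = {y. y 0 = 0 \<and> finite {k. y k \<noteq> 0}}"

lemma finsuppD:
  assumes "y \<in> finsupp"
  shows "finite {k. y k \<noteq> 0}" and "y k \<noteq> 0 \<Longrightarrow> k \<ge> 1"
  using assms by (auto simp: finsupp_def Suc_le_eq intro: gr0I)

lemma combined_zero_index: "cpart y A 0 = 0"
  by (simp add: combined_orbit_part_def orbit_part_zero_index)

lemma combined_0:
  assumes y: "y \<in> finsupp"
  shows "cpart y {0} = y"
proof
  fix l
  have "cpart y {0} l = (\<Sum>k | y k \<noteq> 0. if l = k then y k else 0)"
    unfolding combined_orbit_part_def
    using finsuppD(2)[OF y] by (intro sum.cong) (auto simp: orbit_part_0)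
  then show "cpart y {0} l = y l" using finsuppD(1)[OF y] by simp
qed

lemma T_combined:
  assumes y: "y \<in> finsupp"
  shows "T (cpart y A) = cpart y {i. i + 1 \<in> A}"
proof
  fix l
  show "T (cpart y A) l = cpart y {i. i + 1 \<in> A} l"
  proof (cases "l = 0")
    case False
    have "T (cpart y A) l = (\<Sum>k | y k \<noteq> 0. y k * T (opart k A) l)"
      using False by (simp add: pseudo_shift_def combined_orbit_part_def sum_distrib_left mult.left_commute)
    also have "\<dots> = cpart y {i. i + 1 \<in> A} l"
      unfolding combined_orbit_part_def
      using finsuppD(2)[OF y] by (intro sum.cong) (auto simp: T_orbit_part)
    finally show ?thesis .
  qed (simp add: pseudo_shift_def combined_zero_index)
qed

lemma T_funpow_combined:
  assumes "y \<in> finsupp"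
  shows "(T ^^ n) (cpart y A) = cpart y {i. i + int n \<in> A}"
proof (induction n)
  case (Suc n)
  have "{i. i + 1 \<in> {i. i + int n \<in> A}} = {i. i + int (Suc n) \<in> A}"
    by (simp add: ac_simps)
  then show ?case using Suc by (simp only: funpow.simps comp_apply T_combined[OF assms])
qed simp

lemma combined_in_lp:
  assumes y: "y \<in> finsupp"
  shows "cpart y A \<in> lp p"
    and "lp_norm p (cpart y A) \<le> (\<Sum>k | y k \<noteq> 0. norm (y k) * lp_norm p (opart k A))"
proof -
  have 1: "(\<lambda>l. y k * opart k A l) \<in> lp p"
      "lp_norm p (\<lambda>l. y k * opart k A l) \<le> norm (y k) * lp_norm p (opart k A)" if "y k \<noteq> 0" for k
    using lp_scale[OF p_pos orbit_part_in_lp[OF finsuppD(2)[OF y that]]] by auto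
  have eq: "cpart y A = (\<lambda>l. \<Sum>k | y k \<noteq> 0. y k * opart k A l)"
    by (simp add: fun_eq_iff combined_orbit_part_def)
  have 2: "cpart y A \<in> lp p \<and> lp_norm p (cpart y A) \<le> (\<Sum>k | y k \<noteq> 0. lp_norm p (\<lambda>l. y k * opart k A l))"
    unfolding eq using 1(1) by (intro lp_sum[OF p finsuppD(1)[OF y]]) auto
  then show "cpart y A \<in> lp p" by simp
  have "(\<Sum>k | y k \<noteq> 0. lp_norm p (\<lambda>l. y k * opart k A l))
      \<le> (\<Sum>k | y k \<noteq> 0. norm (y k) * lp_norm p (opart k A))"
    using 1(2) by (intro sum_mono) auto
  with 2 show "lp_norm p (cpart y A) \<le> (\<Sum>k | y k \<noteq> 0. norm (y k) * lp_norm p (opart k A))" by linarith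
qed

lemma combined_far:
  assumes y: "y \<in> finsupp" and e: "e > 0"
  shows "\<exists>M. \<forall>A. (\<forall>i\<in>A. \<bar>i\<bar> \<ge> M) \<longrightarrow> lp_norm p (cpart y A) \<le> e"
proof -
  define K where "K = {k. y k \<noteq> 0}"
  have K: "finite K" "\<And>k. k \<in> K \<Longrightarrow> k \<ge> 1" using finsuppD[OF y] by (auto simp: K_def)
  define S where "S = (\<Sum>k\<in>K. norm (y k)) + 1"
  have S: "S > 0" unfolding S_def by (simp add: add_nonneg_pos sum_nonneg)
  have "\<exists>M. \<forall>A. (\<forall>i\<in>A. \<bar>i\<bar> \<ge> M) \<longrightarrow> lp_norm p (opart k A) < e / S" if "k \<in> K" for k
    using orbit_part_far[OF K(2)[OF that], of "e / S"] e S by simp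
  then obtain M where M: "\<And>k A. k \<in> K \<Longrightarrow> (\<forall>i\<in>A. \<bar>i\<bar> \<ge> M k) \<Longrightarrow> lp_norm p (opart k A) < e / S"
    by metis
  have "lp_norm p (cpart y A) \<le> e" if A: "\<forall>i\<in>A. \<bar>i\<bar> \<ge> Max (insert 0 (M ` K))" for A
  proof -
    have "lp_norm p (opart k A) < e / S" if "k \<in> K" for k
    proof (rule M[OF that])
      have "M k \<le> Max (insert 0 (M ` K))" using K(1) that by (intro Max_ge) auto
      then show "\<forall>i\<in>A. \<bar>i\<bar> \<ge> M k" using A by force
    qed
    then have "(\<Sum>k\<in>K. norm (y k) * lp_norm p (opart k A)) \<le> (\<Sum>k\<in>K. norm (y k) * (e / S))"
      by (intro sum_mono mult_left_mono) (auto intro: less_imp_le)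
    also have "\<dots> = (S - 1) * (e / S)" unfolding sum_distrib_right[symmetric] by (simp add: S_def)
    also have "\<dots> \<le> S * (e / S)" using e S by (intro mult_right_mono) auto
    also have "\<dots> = e" using S by simp
    finally show ?thesis using combined_in_lp(2)[OF y, of A] by (simp add: K_def)
  qed
  then show ?thesis by blast
qed

lemma combined_Un:
  assumes y: "y \<in> finsupp" and "A \<inter> B = {}"
  shows "cpart y (A \<union> B) l = cpart y A l + cpart y B l"
  unfolding combined_orbit_part_def sum.distrib[symmetric]
  using orbit_part_Un[OF finsuppD(2)[OF y] assms(2)] by (intro sum.cong) (auto simp: distrib_left)

end

context summable_pseudo_shift
begin

section \<open>The three conditions imply chaos\<close>

text \<open>
  A periodic vector near a finitely supported \<open>y\<close>: add to \<open>y\<close> all entries of its orbit vector at the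
  nonzero multiples of a large period \<open>N\<close>. The set of positions is then invariant under the shift by
  \<open>N\<close>, and the added entries lie far out.
\<close>

lemma periodic_points_dense: "dense_in (lp_topology p) (periodic_points D T)"
  unfolding dense_in_lp_iff[OF p]
proof (intro ballI allI impI)
  fix x :: "nat \<Rightarrow> 'a" and r :: real
  assume x: "x \<in> lp p" and r: "r > 0"
  obtain Y :: "nat \<Rightarrow> nat \<Rightarrow> 'a" where "\<And>j. Y j 0 = 0" "\<And>j. finite {k. Y j k \<noteq> 0}"
    and near: "\<And>x e m. x \<in> lp p \<Longrightarrow> e > 0 \<Longrightarrow> \<exists>j\<ge>m. lp_norm p (\<lambda>k. x k - Y j k) < e"
    using lp_finsupp_dense_sequence[OF p] by blast
  then have Y: "Y j \<in> finsupp" for j by (simp add: finsupp_def)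
  obtain j where j: "lp_norm p (\<lambda>k. x k - Y j k) < r / 2" using near[OF x, of "r / 2"] r by auto
  define y where "y = Y j"
  have y: "y \<in> finsupp" by (simp add: y_def Y)
  obtain M where M: "\<And>A. (\<forall>i\<in>A. \<bar>i\<bar> \<ge> M) \<Longrightarrow> lp_norm p (cpart y A) \<le> r / 2"
    using combined_far[OF y, of "r / 2"] r by auto
  define N where "N = nat M + 1"
  define A where "A = {i. int N dvd i}"
  define z where "z = cpart y A"
  have z: "(T ^^ n) z \<in> lp p" for n unfolding z_def T_funpow_combined[OF y] by (rule combined_in_lp(1)[OF y])
  have "{i. i + int N \<in> A} = A" by (simp add: A_def)
  then have "(T ^^ N) z = z" unfolding z_def by (simp add: T_funpow_combined[OF y])
  moreover have "N \<ge> 1" by (simp add: N_def)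
  moreover have "z \<in> power_domain D T N"
    unfolding power_domain_pseudo_shift[OF \<open>N \<ge> 1\<close>] using z z[of 0] by simp
  ultimately have "z \<in> periodic_points D T" by (auto simp: periodic_points_def)
  have "\<bar>i\<bar> \<ge> M" if "i \<in> A - {0}" for i
  proof -
    have "\<bar>int N\<bar> \<le> \<bar>i\<bar>" using that by (intro dvd_imp_le_int) (auto simp: A_def)
    moreover have "M \<le> int N" unfolding N_def by linarith
    ultimately show ?thesis by linarith
  qed
  then have far: "lp_norm p (cpart y (A - {0})) \<le> r / 2" by (intro M) auto
  have "cpart y ({0} \<union> (A - {0})) l = cpart y {0} l + cpart y (A - {0}) l" for l
    by (rule combined_Un[OF y]) auto
  moreover have "{0} \<union> (A - {0}) = A" by (auto simp: A_def)
  ultimately have split: "x l - z l = (x l - Y j l) + (- 1) * cpart y (A - {0}) l" for l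
    by (simp add: z_def combined_0[OF y]) (simp add: y_def)
  have neg: "(\<lambda>l. (- 1) * cpart y (A - {0}) l) \<in> lp p"
      "lp_norm p (\<lambda>l. (- 1) * cpart y (A - {0}) l) \<le> r / 2"
    using lp_scale[OF p_pos combined_in_lp(1)[OF y], of "- 1" "A - {0}"] far by auto
  have "Y j \<in> lp p" using combined_in_lp(1)[OF y, of "{0}"] by (simp add: combined_0[OF y]) (simp add: y_def)
  then have "lp_norm p (\<lambda>l. x l - z l) \<le> lp_norm p (\<lambda>l. x l - Y j l) + lp_norm p (\<lambda>l. (- 1) * cpart y (A - {0}) l)"
    unfolding split using lp_Minkowski[OF p lp_diff[OF p x] neg(1)] by blast
  then have "lp_norm p (\<lambda>l. x l - z l) < r" using j neg(2) by linarith
  then show "\<exists>z\<in>periodic_points D T. z \<in> lp p \<and> lp_norm p (\<lambda>k. x k - z k) < r"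
    using \<open>z \<in> periodic_points D T\<close> z[of 0] by auto
qed

text \<open>
  The hypercyclic vector \<open>f\<close> is a series: \<open>y\<^sub>j\<close> runs through a dense sequence, and the \<open>j\<close>-th term is \<open>y\<^sub>j\<close>
  moved to position \<open>n\<^sub>j\<close>, so that it takes the time \<open>n\<^sub>j\<close> to come back. At time \<open>n\<^sub>i\<close> the \<open>i\<close>-th term
  has become \<open>y\<^sub>i\<close> and the \<open>j\<close>-th one is \<open>y\<^sub>j\<close> at position \<open>n\<^sub>j - n\<^sub>i\<close>. The times grow so fast that this
  position is far out for \<open>y\<^sub>j\<close>, with norm at most \<open>(1/2)\<^sup>i (1/2)\<^sup>j\<close>, for all \<open>j \<noteq> i\<close>.
\<close>

lemma hypercyclic_vector_exists:
  obtains f where "\<And>m. (T ^^ m) f \<in> lp p" and "dense_in (lp_topology p) (range (\<lambda>m. (T ^^ m) f))"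
proof -
  obtain Y :: "nat \<Rightarrow> nat \<Rightarrow> 'a" where "\<And>j. Y j 0 = 0" "\<And>j. finite {k. Y j k \<noteq> 0}"
    and near: "\<And>x e m. x \<in> lp p \<Longrightarrow> e > 0 \<Longrightarrow> \<exists>j\<ge>m. lp_norm p (\<lambda>k. x k - Y j k) < e"
    using lp_finsupp_dense_sequence[OF p] by blast
  then have Y: "Y j \<in> finsupp" for j by (simp add: finsupp_def)
  have "\<exists>M. \<forall>A. (\<forall>a\<in>A. \<bar>a\<bar> \<ge> M) \<longrightarrow> lp_norm p (cpart (Y i) A) \<le> (1 / 4) ^ j" for i j
    by (rule combined_far[OF Y]) simp
  then obtain M where M: "\<And>i j A. (\<forall>a\<in>A. \<bar>a\<bar> \<ge> M i j) \<Longrightarrow> lp_norm p (cpart (Y i) A) \<le> (1 / 4) ^ j"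
    by metis
  \<comment> \<open>The summand \<open>1\<close> makes \<open>n j \<ge> j\<close>, so that for each \<open>m\<close> the late terms of \<open>T\<^sup>m f\<close> are still far out.\<close>
  define gap where "gap j = nat (Max ((\<lambda>i. M i j) ` {..j})) + 1" for j
  have gap: "lp_norm p (cpart (Y i) {a}) \<le> (1 / 4) ^ j" if "i \<le> j" "\<bar>a\<bar> \<ge> int (gap j)" for i j a
  proof (rule M)
    have "M i j \<le> Max ((\<lambda>i. M i j) ` {..j})" using \<open>i \<le> j\<close> by (intro Max_ge) auto
    also have "\<dots> \<le> int (gap j)" unfolding gap_def by linarith
    finally show "\<forall>b\<in>{a}. \<bar>b\<bar> \<ge> M i j" using \<open>\<bar>a\<bar> \<ge> int (gap j)\<close> by simp
  qed
  define n where "n j = (\<Sum>i\<le>j. gap i)" for j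
  have n_diff: "n j \<ge> n i + gap j" if "i < j" for i j
  proof -
    have "n i + gap j = (\<Sum>k\<in>insert j {..i}. gap k)" using that by (simp add: n_def)
    also have "\<dots> \<le> n j" unfolding n_def using that by (intro sum_mono2) auto
    finally show ?thesis .
  qed
  have n_ge: "n j \<ge> j" for j
  proof -
    have "(\<Sum>i\<le>j. 1) \<le> n j" unfolding n_def by (rule sum_mono) (simp add: gap_def)
    then show ?thesis by simp
  qed
  define u where "u m j = cpart (Y j) {int (n j) - int m}" for m j
  have u_lp: "u m j \<in> lp p" for m j unfolding u_def by (rule combined_in_lp(1)[OF Y])
  have T_u: "(T ^^ m) (u 0 j) = u m j" for m j
  proof -
    have "{i. i + int m \<in> {int (n j)}} = {int (n j) - int m}" by auto
    then show ?thesis by (simp add: u_def T_funpow_combined[OF Y])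
  qed
  have u_summable: "summable (\<lambda>j. lp_norm p (u m j))" for m
  proof (rule summable_comparison_test'[of "\<lambda>j. (1 / 4) ^ j" "Suc m"])
    show "summable (\<lambda>j. (1 / 4 :: real) ^ j)" by (rule summable_geometric) simp
    fix j assume j: "j \<ge> Suc m"
    have "int (gap j) \<le> \<bar>int (n j) - int m\<bar>" using n_diff[of m j] n_ge[of m] j by linarith
    then show "norm (lp_norm p (u m j)) \<le> (1 / 4) ^ j" using gap[of j j] by (simp add: u_def)
  qed
  define f where "f l = (\<Sum>j. u 0 j l)" for l
  have T_f: "(T ^^ m) f = (\<lambda>l. \<Sum>j. u m j l)" for m
  proof (cases "m = 0")
    case False
    show ?thesis
    proof
      fix l
      show "(T ^^ m) f l = (\<Sum>j. u m j l)"
      proof (cases "l = 0")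
        case True
        have "(T ^^ m) f 0 = 0" using \<open>m \<noteq> 0\<close> by (cases m) (simp_all add: pseudo_shift_def)
        then show ?thesis using True by (simp add: u_def combined_zero_index)
      next
        case False
        then have l: "l \<ge> 1" by simp
        have "(T ^^ m) f l = (\<Sum>j. W m l * u 0 j ((\<phi> ^^ m) l))"
          unfolding T_funpow[OF l] f_def using lp_suminf(1)[OF p u_lp u_summable, of 0]
          by (simp add: suminf_mult)
        also have "\<dots> = (\<Sum>j. u m j l)"
          by (simp only: T_funpow[OF l, symmetric] T_u)
        finally show ?thesis .
      qed
    qed
  qed (simp add: f_def fun_eq_iff)
  have in_lp: "(T ^^ m) f \<in> lp p" for m
    unfolding T_f by (rule lp_suminf(2)[OF p u_lp u_summable])
  have close: "lp_norm p (\<lambda>l. (T ^^ n i) f l - Y i l) \<le> 2 * (1 / 2) ^ i" for i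
  proof -
    define v where "v j = (if j = i then (\<lambda>l. 0) else u (n i) j)" for j
    have v_lp: "v j \<in> lp p" for j by (simp add: v_def u_lp lp_zero[OF p_pos])
    have v_norm: "lp_norm p (v j) \<le> (1 / 2) ^ i * (1 / 2) ^ j" for j
    proof -
      consider "j = i" | "i < j" | "j < i" by linarith
      then show ?thesis
      proof cases
        case 1
        then show ?thesis by (simp add: v_def lp_zero[OF p_pos])
      next
        case 2
        then have "lp_norm p (v j) \<le> (1 / 4) ^ j"
          using gap[of j j "int (n j) - int (n i)"] n_diff[OF 2] by (simp add: v_def u_def)
        also have "(1 / 4 :: real) ^ j = (1 / 2) ^ j * (1 / 2) ^ j"
          by (simp flip: power_mult_distrib)
        also have "\<dots> \<le> (1 / 2) ^ i * (1 / 2) ^ j"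
          using 2 by (intro mult_right_mono power_decreasing) auto
        finally show ?thesis .
      next
        case 3
        then have "lp_norm p (v j) \<le> (1 / 4) ^ i"
          using gap[of j i "int (n j) - int (n i)"] n_diff[OF 3] by (simp add: v_def u_def)
        also have "(1 / 4 :: real) ^ i = (1 / 2) ^ i * (1 / 2) ^ i"
          by (simp flip: power_mult_distrib)
        also have "\<dots> \<le> (1 / 2) ^ i * (1 / 2) ^ j"
          using 3 by (intro mult_left_mono power_decreasing) auto
        finally show ?thesis .
      qed
    qed
    have geo: "summable (\<lambda>j. (1 / 2) ^ i * (1 / 2 :: real) ^ j)"
      by (intro summable_mult summable_geometric) simp
    then have v_summable: "summable (\<lambda>j. lp_norm p (v j))"
      by (rule summable_comparison_test'[of _ 0]) (use v_norm in auto)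
    have "(T ^^ n i) f l - Y i l = (\<Sum>j. v j l)" for l
    proof -
      have ui: "u (n i) i = Y i" by (simp add: u_def combined_0[OF Y])
      have "(\<lambda>j. u (n i) j l - (if j = i then u (n i) j l else 0)) sums ((T ^^ n i) f l - u (n i) i l)"
        unfolding T_f by (intro sums_diff summable_sums lp_suminf(1)[OF p u_lp u_summable] sums_single)
      moreover have "(\<lambda>j. u (n i) j l - (if j = i then u (n i) j l else 0)) = (\<lambda>j. v j l)"
        by (auto simp: v_def)
      ultimately show ?thesis unfolding ui by (simp add: sums_unique)
    qed
    then have "lp_norm p (\<lambda>l. (T ^^ n i) f l - Y i l) \<le> (\<Sum>j. lp_norm p (v j))"
      using lp_suminf(3)[OF p v_lp v_summable] by simp
    also have "\<dots> \<le> (\<Sum>j. (1 / 2) ^ i * (1 / 2) ^ j)"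
      by (rule suminf_le[OF v_norm v_summable geo])
    also have "\<dots> = 2 * (1 / 2) ^ i"
      by (simp add: suminf_mult suminf_geometric)
    finally show ?thesis .
  qed
  have "dense_in (lp_topology p) (range (\<lambda>m. (T ^^ m) f))"
    unfolding dense_in_lp_iff[OF p]
  proof (intro ballI allI impI)
    fix x :: "nat \<Rightarrow> 'a" and r :: real
    assume x: "x \<in> lp p" and r: "r > 0"
    obtain m where m: "(1 / 2 :: real) ^ m < r / 4"
      using real_arch_pow_inv[of "r / 4" "1 / 2"] r by auto
    obtain i where i: "i \<ge> m" "lp_norm p (\<lambda>k. x k - Y i k) < r / 2"
      using near[OF x, of "r / 2" m] r by auto
    have "(1 / 2 :: real) ^ i \<le> (1 / 2) ^ m" using i(1) by (intro power_decreasing) auto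
    then have ci: "lp_norm p (\<lambda>l. (T ^^ n i) f l - Y i l) < r / 2" using close[of i] m by linarith
    have Yi: "Y i \<in> lp p" using combined_in_lp(1)[OF Y, of i "{0}"] by (simp add: combined_0[OF Y])
    have "lp_dist p x ((T ^^ n i) f) \<le> lp_dist p x (Y i) + lp_dist p (Y i) ((T ^^ n i) f)"
      by (rule Metric_space.triangle[OF lp_Metric_space[OF p] x Yi in_lp])
    also have "lp_dist p (Y i) ((T ^^ n i) f) = lp_dist p ((T ^^ n i) f) (Y i)"
      by (rule Metric_space.commute[OF lp_Metric_space[OF p]])
    finally have "lp_norm p (\<lambda>k. x k - (T ^^ n i) f k) < r"
      using i(2) ci by (simp add: lp_dist_def)
    then show "\<exists>y\<in>range (\<lambda>m. (T ^^ m) f). y \<in> lp p \<and> lp_norm p (\<lambda>k. x k - y k) < r"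
      using in_lp by blast
  qed
  then show ?thesis using that in_lp by blast
qed

theorem pseudo_shift_chaotic: "chaotic (lp_topology p) D T"
proof -
  obtain f where f: "\<And>m. (T ^^ m) f \<in> lp p" "dense_in (lp_topology p) (range (\<lambda>m. (T ^^ m) f))"
    using hypercyclic_vector_exists by blast
  have "f \<in> power_domain_inf D T"
    unfolding power_domain_inf_pseudo_shift using f(1) f(1)[of 0] by auto
  moreover have "range (\<lambda>m. (T ^^ m) f) \<subseteq> D"
    using f(1) f(1)[of "Suc _"] by (auto simp: pseudo_shift_domain_def)
  then have "dense_in (lp_topology p) D"
    using f(2) unfolding dense_in_lp_iff[OF p] by blast
  ultimately show ?thesis
    using f(2) periodic_points_dense by (auto simp: chaotic_def hypercyclic_def)
qed

end

section \<open>The characterization\<close>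

lemma infsum_ennreal_finite_iff:
  assumes "\<And>n. n \<in> A \<Longrightarrow> f n \<ge> 0"
  shows "(\<Sum>\<^sub>\<infinity>n\<in>A. ennreal (f n)) < \<infinity> \<longleftrightarrow> f summable_on A"
proof
  assume fin: "(\<Sum>\<^sub>\<infinity>n\<in>A. ennreal (f n)) < \<infinity>"
  show "f summable_on A"
  proof (rule nonneg_bdd_above_summable_on[OF assms])
    have "sum f F \<le> enn2real (\<Sum>\<^sub>\<infinity>n\<in>A. ennreal (f n))" if F: "F \<subseteq> A" "finite F" for F
    proof -
      have "ennreal (sum f F) = (\<Sum>n\<in>F. ennreal (f n))"
        using F assms by (intro sum_ennreal[symmetric]) auto
      also have "\<dots> = (\<Sum>\<^sub>\<infinity>n\<in>F. ennreal (f n))" using F by simp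
      also have "\<dots> \<le> (\<Sum>\<^sub>\<infinity>n\<in>A. ennreal (f n))"
        using F by (intro infsum_mono_neutral nonneg_summable_on_complete) auto
      finally have "enn2real (ennreal (sum f F)) \<le> enn2real (\<Sum>\<^sub>\<infinity>n\<in>A. ennreal (f n))"
        using fin by (intro enn2real_mono) auto
      moreover have "sum f F \<ge> 0" using F assms by (intro sum_nonneg) auto
      ultimately show ?thesis by simp
    qed
    then show "bdd_above (sum f ` {F. F \<subseteq> A \<and> finite F})" by (intro bdd_aboveI2) auto
  qed auto
next
  assume f: "f summable_on A"
  have "(\<Sum>\<^sub>\<infinity>n\<in>A. ennreal (f n)) = (SUP F\<in>{F. finite F \<and> F \<subseteq> A}. (\<Sum>n\<in>F. ennreal (f n)))"
    by (rule nonneg_infsum_complete) simp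
  also have "\<dots> = (SUP F\<in>{F. finite F \<and> F \<subseteq> A}. ennreal (sum f F))"
    using assms by (intro SUP_cong refl sum_ennreal) auto
  also have "\<dots> = ennreal (infsum f A)"
    using infsum_nonneg_is_SUPREMUM_ennreal[OF f] assms by simp
  finally show "(\<Sum>\<^sub>\<infinity>n\<in>A. ennreal (f n)) < \<infinity>" by simp
qed

text \<open>A vanishing product makes its own term of the series infinite, as \<open>1 / 0 = \<infinity>\<close> for extended reals.\<close>

lemma forward_series_finite_iff:
  fixes c :: "nat \<Rightarrow> 'a::real_normed_field"
  assumes "c 0 \<noteq> 0"
  shows "(\<Sum>\<^sub>\<infinity>n\<in>{1..}. 1 / ennreal (norm (c n) powr p)) < \<infinity> \<longleftrightarrow>
    (\<forall>n. c n \<noteq> 0) \<and> (\<lambda>n. 1 / norm (c n) powr p) summable_on {1..}"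
proof (cases "\<forall>n. c n \<noteq> 0")
  case True
  then have "1 / ennreal (norm (c n) powr p) = ennreal (1 / norm (c n) powr p)" for n
    using divide_ennreal[of 1 "norm (c n) powr p"] by simp
  then show ?thesis
    using True infsum_ennreal_finite_iff[of "{1..}" "\<lambda>n. 1 / norm (c n) powr p"] by simp
next
  case False
  then obtain n where n: "c n = 0" by blast
  then have n1: "n \<ge> 1" using assms by (cases n) auto
  have "1 / ennreal (norm (c n) powr p) = (\<Sum>\<^sub>\<infinity>n\<in>{n}. 1 / ennreal (norm (c n) powr p))" by simp
  also have "\<dots> \<le> (\<Sum>\<^sub>\<infinity>n\<in>{1..}. 1 / ennreal (norm (c n) powr p))"
    using n1 by (intro infsum_mono_neutral nonneg_summable_on_complete) auto
  finally have "(\<Sum>\<^sub>\<infinity>n\<in>{1..}. 1 / ennreal (norm (c n) powr p)) = \<infinity>"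
    using n by (simp add: top_unique)
  then show ?thesis using False by simp
qed

theorem theorem1p7:
  fixes p :: real
    and \<phi> :: "nat \<Rightarrow> nat"
    and w :: "nat \<Rightarrow> 'a::{real_normed_field, euclidean_space}"
  assumes "1 \<le> p"
    and "\<phi> \<in> {1..} \<rightarrow> {1..}"
    and "w 0 = 0"
    and "pseudo_shift_unbounded p \<phi> w"
  shows "chaotic (lp_topology p) (pseudo_shift_domain p \<phi> w) (pseudo_shift \<phi> w) \<longleftrightarrow>
    inj_on \<phi> {1..} \<and>
    (\<forall>n\<ge>1. \<not> (\<exists>k\<ge>1. (\<phi> ^^ n) k = k)) \<and>
    (\<forall>k\<ge>1.
      (\<Sum>\<^sub>\<infinity>n\<in>{1..}. 1 / ennreal (norm (\<Prod>j<n. w ((\<phi> ^^ j) k)) powr p)) < \<infinity> \<and>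
      (\<Sum>\<^sub>\<infinity>n\<in>{1..}. ennreal (norm (\<Prod>j=1..n. w (neg_iterate \<phi> j k)) powr p)) < \<infinity>)"
    (is "?chaos \<longleftrightarrow> ?inj \<and> ?nofix \<and> (\<forall>k\<ge>1. ?forward k \<and> ?backward k)")
proof -
  interpret lp_pseudo_shift p \<phi> w using assms by unfold_locales
  have forward_iff: "?forward k \<longleftrightarrow>
      (\<forall>n. W n k \<noteq> 0) \<and> (\<lambda>n. 1 / norm (W n k) powr p) summable_on {1..}" for k
    unfolding orbit_weight_def by (rule forward_series_finite_iff) simp
  have backward_iff: "?backward k \<longleftrightarrow>
      (\<lambda>n. norm (\<Prod>j=1..n. w (neg_iterate \<phi> j k)) powr p) summable_on {1..}" for k
    by (rule infsum_ennreal_finite_iff) simp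
  show ?thesis
  proof
    assume chaos: ?chaos
    then obtain f where dense: "dense_in (lp_topology p) (range (\<lambda>n. (T ^^ n) f))"
      by (auto simp: chaotic_def hypercyclic_def)
    have inj: ?inj by (rule dense_orbit_inj_on[OF dense])
    have nofix: "\<And>n k. n \<ge> 1 \<Longrightarrow> k \<ge> 1 \<Longrightarrow> (\<phi> ^^ n) k \<noteq> k"
      by (rule dense_orbit_no_fixed_point[OF dense])
    have "?forward k \<and> ?backward k" if k: "k \<ge> 1" for k
    proof -
      have "dense_in (lp_topology p) (periodic_points D T)" using chaos by (simp add: chaotic_def)
      then obtain x where x: "x \<in> periodic_points D T" "\<And>i. norm ((if i = k then 1 else 0) - x i) < 1"
        using dense_in_lp_coordinates[OF p _ single_in_lp(1)[OF p_pos k, of 1], of "periodic_points D T" 1] by auto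
      have "x k \<noteq> 0" using x(2)[of k] by auto
      then show ?thesis
        unfolding forward_iff backward_iff
        using periodic_vector_summability[OF inj nofix assms(3) x(1) k] by blast
    qed
    with inj nofix show "?inj \<and> ?nofix \<and> (\<forall>k\<ge>1. ?forward k \<and> ?backward k)" by blast
  next
    assume conds: "?inj \<and> ?nofix \<and> (\<forall>k\<ge>1. ?forward k \<and> ?backward k)"
    have "w k \<noteq> 0" if "k \<ge> 1" for k
      using conds that forward_iff[of k] orbit_weight_Suc[of \<phi> w 0 k] by auto
    then interpret summable_pseudo_shift p \<phi> w
      using conds forward_iff backward_iff by unfold_locales blast+
    show ?chaos by (rule pseudo_shift_chaotic)
  qed
qed

end
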